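(* Let $n\ge 1$ and let $k_1,\dots,k_I$ be positive integers with $k_1+\cdots+k_I=n$. In the set of Hermitian matrices of order $n$, the real codimension of the subset of those having exactly $I$ distinct eigenvalues with multiplicities $k_1,\dots,k_I$ is $$\sum_{i=1}^I (k_i^2-1).$$
   Context: A complex $n\times n$ matrix $A$ is Hermitian if $A=A^\ast$, where $A^\ast$ is the adjoint (conjugate transpose). The set of Hermitian matrices of order $n$ is a real vector space of real dimension $n^2$. "Real dimension" of a subset is the usual dimension over $\mathbb R$ (of a real manifold, or of a semialgebraic set), and the real codimension is $n^2$ minus the real dimension of the subset. The values of the eigenvalues are not prescribed. *)

theory Defs
  imports "HOL-Analysis.Analysis" "HOL-Computational_Algebra.Polynomial"
begin

definition adjoint_matrix :: "complex^'n^'m \<Rightarrow> complex^'m^'n"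
  where "adjoint_matrix A = (\<chi> i j. cnj (A $ j $ i))"

definition hermitian_matrices :: "(complex^'n^'n) set"
  where "hermitian_matrices = {A. adjoint_matrix A = A}"

definition eigenvalues :: "'a::field^'n^'n \<Rightarrow> 'a set"
  where "eigenvalues A = {c. \<exists>v. v \<noteq> 0 \<and> A *v v = c *s v}"

text \<open>The determinant of \<open>X I - A\<close>, computed over the polynomial ring.\<close>

definition charpoly :: "'a::comm_ring_1^'n^'n \<Rightarrow> 'a poly"
  where "charpoly A = det (\<chi> i j. (if i = j then [:0, 1:] else 0) - [:A $ i $ j:])"

definition multiplicity_eigenvalue :: "'a::field^'n^'n \<Rightarrow> 'a \<Rightarrow> nat"
  where "multiplicity_eigenvalue A c = order c (charpoly A)"

text \<open>The multiplicities are attached to the eigenvalues in an arbitrary order: \<open>bij_betw\<close> makes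
  \<open>c 1, \<dots>, c I\<close> an enumeration without repetition of all eigenvalues, not an increasing one.\<close>

definition hermitian_with_multiplicities :: "nat \<Rightarrow> (nat \<Rightarrow> nat) \<Rightarrow> (complex^'n^'n) set"
  where "hermitian_with_multiplicities I k =
    {A \<in> hermitian_matrices.
       \<exists>c. bij_betw c {1..I} (eigenvalues A) \<and>
           (\<forall>i\<in>{1..I}. multiplicity_eigenvalue A (c i) = k i)}"

text \<open>Differentiability of class \<open>C\<^sup>k\<close> on an open set, by recursion on directional derivatives;
  in finite dimension this agrees with continuity of the iterated Frechet derivatives.\<close>

primrec Ck_on :: "nat \<Rightarrow> ('a::real_normed_vector \<Rightarrow> 'b::real_normed_vector) \<Rightarrow> 'a set \<Rightarrow> bool"
  where
    "Ck_on 0 f U \<longleftrightarrow> continuous_on U f"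
  | "Ck_on (Suc k) f U \<longleftrightarrow>
       (\<forall>x\<in>U. f differentiable (at x)) \<and>
       (\<forall>v. Ck_on k (\<lambda>x. frechet_derivative f (at x) v) U)"

definition smooth_on :: "('a::real_normed_vector \<Rightarrow> 'b::real_normed_vector) \<Rightarrow> 'a set \<Rightarrow> bool"
  where "smooth_on f U \<longleftrightarrow> (\<forall>k. Ck_on k f U)"

text \<open>Embedded smooth submanifolds of a Euclidean space, by regular local parametrizations: near
  each of its points, \<open>M\<close> is the homeomorphic image of an open subset of a \<open>d\<close>-dimensional space
  under a smooth map with injective differential. As \<open>d\<close> is a number and not a type, a
  \<open>d\<close>-dimensional subspace \<open>T\<close> of the ambient space takes the place of \<open>d\<close>-space; since \<open>d\<close> cannot
  exceed the ambient dimension, nothing is lost. A smooth map on \<open>T \<inter> U\<close> extends to an open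
  subset of the ambient space by composition with the orthogonal projection onto \<open>T\<close>, so we can
  ask for \<open>f\<close> to be defined and smooth on an open subset of the ambient space.\<close>

definition smooth_submanifold :: "nat \<Rightarrow> 'a::euclidean_space set \<Rightarrow> bool"
  where "smooth_submanifold d M \<longleftrightarrow>
    (\<forall>p\<in>M. \<exists>V (T :: 'a set) U f g.
        open V \<and> p \<in> V \<and>
        subspace T \<and> dim T = d \<and> open U \<and> smooth_on f U \<and>
        homeomorphism (T \<inter> U) (M \<inter> V) f g \<and>
        (\<forall>x\<in>T \<inter> U. inj_on (frechet_derivative f (at x)) T))"

text \<open>The dimension of a subset: the largest dimension of a nonempty submanifold contained in it.
  It is the manifold dimension when the subset is itself a submanifold, and the usual dimension
  when the subset is semialgebraic. Only dimensions \<open>d \<le> DIM('a)\<close> occur, so \<open>Sup\<close> is a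
  maximum unless \<open>S\<close> is empty.\<close>

definition real_dimension :: "'a::euclidean_space set \<Rightarrow> nat"
  where "real_dimension S = Sup {d. \<exists>M. M \<noteq> {} \<and> M \<subseteq> S \<and> smooth_submanifold d M}"

definition real_codimension :: "'a::euclidean_space set \<Rightarrow> 'a set \<Rightarrow> int"
  where "real_codimension V S = int (dim V) - int (real_dimension S)"

end

theory Submission
  imports Defs
begin

text \<open>Lower bound on the dimension: fix a real diagonal matrix \<open>D\<close> with the prescribed block
  structure. Conjugating the nearby block-scalar diagonal matrices by Cayley transforms
  \<open>(1 + K) (1 - K)\<^sup>-\<^sup>1\<close> of skew-hermitian matrices \<open>K\<close> with vanishing diagonal blocks is an immersion
  at \<open>D\<close> with values in the set of the theorem.

  Upper bound: let \<open>A(t)\<close> be a differentiable curve in the set, with \<open>A(0) = D\<close> diagonal after a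
  unitary change of basis. As the number of distinct eigenvalues is constant, the eigenprojections
  of \<open>A(t)\<close> converge (along a subsequence) to those of \<open>D\<close>, and dividing
  \<open>(A(t) - D) G(t) = (\<lambda>(t) - D) G(t)\<close> by \<open>t\<close> shows that every diagonal block of \<open>A'(0)\<close> is scalar. The
  hermitian matrices with this property form a space of dimension \<open>n\<^sup>2 - \<Sum> k\<^sub>i\<^sup>2 + I\<close>, which is also
  the dimension of the source of the immersion above.\<close>

section \<open>Matrix algebra and characteristic polynomials\<close>

text \<open>\<open>real_dimension\<close> is a supremum over submanifolds contained in the set, so
  the set itself is never shown to be a manifold: one chart around one point gives the lower bound,
  while the upper bound has to treat an arbitrary parametrization at one of its points. The obstacle
  there is that a differentiable curve of matrices comes with no differentiable, nor even
  continuous, choice of eigenvectors. Only subsequential limits of them are used: the divided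
  equation contains no derivative of G, on the rows of one block D acts as a scalar, and on the
  columns of that block G tends to the identity. Cayley transforms serve the lower bound because 1 -
  K is invertible for every skew-hermitian K, so the map is smooth on the whole matrix space, and
  because differentiating G = (1 - K)^-1 only yields products of G with constants. The two
  dimensions agree for a reason: between different blocks the commutator with D is invertible, so
  conjugation reaches every direction there, and moving the eigenvalues gives the block-scalar
  diagonals.\<close>

definition unitary_matrix :: "complex^'n^'n \<Rightarrow> bool"
  where "unitary_matrix Q \<longleftrightarrow> adjoint_matrix Q ** Q = mat 1"

definition diag_matrix :: "('n \<Rightarrow> 'a::zero) \<Rightarrow> 'a^'n^'n"
  where "diag_matrix d = (\<chi> i j. if i = j then d i else 0)"

lemma adjoint_matrix_mult:
  "adjoint_matrix (A ** B) = adjoint_matrix B ** adjoint_matrix A"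
  by (simp add: adjoint_matrix_def matrix_matrix_mult_def vec_eq_iff mult.commute)

lemma adjoint_matrix_adjoint [simp]: "adjoint_matrix (adjoint_matrix A) = A"
  by (simp add: adjoint_matrix_def vec_eq_iff)

lemma adjoint_matrix_mat_1 [simp]: "adjoint_matrix (mat 1) = mat 1"
  by (simp add: adjoint_matrix_def vec_eq_iff mat_def)

lemma adjoint_matrix_diag:
  "adjoint_matrix (diag_matrix d) = diag_matrix (\<lambda>i. cnj (d i))"
  by (simp add: adjoint_matrix_def vec_eq_iff diag_matrix_def)

lemma linear_adjoint_matrix: "linear (adjoint_matrix :: complex^'n^'m \<Rightarrow> complex^'m^'n)"
  by (rule linearI) (simp_all add: adjoint_matrix_def vec_eq_iff)

lemma adjoint_matrix_diff: "adjoint_matrix (A - B) = adjoint_matrix A - adjoint_matrix B"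
  by (simp add: adjoint_matrix_def vec_eq_iff)

lemma adjoint_matrix_add: "adjoint_matrix (A + B) = adjoint_matrix A + adjoint_matrix B"
  by (simp add: adjoint_matrix_def vec_eq_iff)

lemma inner_adjoint_matrix:
  fixes A :: "complex^'n^'m"
  shows "(A *v x) \<bullet> y = x \<bullet> (adjoint_matrix A *v y)"
proof -
  have *: "a \<bullet> b = Re (a * cnj b)" for a b :: complex
    by (simp add: inner_complex_def)
  have "(A *v x) \<bullet> y = Re (\<Sum>i\<in>UNIV. \<Sum>j\<in>UNIV. A $ i $ j * x $ j * cnj (y $ i))"
    by (simp add: inner_vec_def * matrix_vector_mult_def sum_distrib_right)
  also have "\<dots> = Re (\<Sum>j\<in>UNIV. \<Sum>i\<in>UNIV. A $ i $ j * x $ j * cnj (y $ i))"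
    by (subst sum.swap) simp
  also have "\<dots> = x \<bullet> (adjoint_matrix A *v y)"
    by (simp add: inner_vec_def * matrix_vector_mult_def sum_distrib_left adjoint_matrix_def
        mult_ac)
  finally show ?thesis .
qed

lemma unitary_matrix_right:
  "unitary_matrix Q \<Longrightarrow> Q ** adjoint_matrix Q = mat 1"
  unfolding unitary_matrix_def using matrix_left_right_inverse by blast

lemma unitary_matrix_left:
  "unitary_matrix Q \<Longrightarrow> adjoint_matrix Q ** Q = mat 1"
  unfolding unitary_matrix_def .

lemma bounded_bilinear_matrix_mult:
  "bounded_bilinear ((**) :: complex^'n^'m \<Rightarrow> complex^'k^'n \<Rightarrow> complex^'k^'m)"
proof -
  have "bilinear ((**) :: complex^'n^'m \<Rightarrow> complex^'k^'n \<Rightarrow> complex^'k^'m)"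
    unfolding bilinear_def
    by (auto intro!: linearI simp: matrix_matrix_mult_def vec_eq_iff algebra_simps sum.distrib
        scaleR_sum_right)
  then show ?thesis
    by (simp add: bilinear_conv_bounded_bilinear)
qed

lemma matrix_mult_diff_left: "(A - B) ** C = A ** C - B ** (C :: 'a::comm_ring_1^'k^'n)"
  by (simp add: matrix_matrix_mult_def vec_eq_iff algebra_simps sum_subtractf)

lemma matrix_mult_diff_right: "C ** (A - B) = C ** A - C ** (B :: 'a::comm_ring_1^'k^'n)"
  by (simp add: matrix_matrix_mult_def vec_eq_iff algebra_simps sum_subtractf)

lemma matrix_add_rdistrib: "(A + B) ** C = A ** C + B ** (C :: 'a::semiring_1^'k^'n)"
  by (simp add: matrix_matrix_mult_def vec_eq_iff distrib_right sum.distrib)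

lemma diag_matrix_mult_right: "(A ** diag_matrix d) $ i $ j = A $ i $ j * d j"
  for A :: "'a::comm_ring_1^'n^'m"
  by (simp add: matrix_matrix_mult_def diag_matrix_def if_distrib [of "(*) _"] cong: if_cong)

lemma diag_matrix_mult_left: "(diag_matrix d ** A) $ i $ j = d i * A $ i $ j"
  for A :: "'a::comm_ring_1^'m^'n"
  by (simp add: matrix_matrix_mult_def diag_matrix_def if_distrib [of "\<lambda>x. x * _"] cong: if_cong)

lemma diag_matrix_mult_vec: "(diag_matrix d *v x) $ i = d i * x $ i"
  for x :: "'a::comm_ring_1^'n"
  by (simp add: matrix_vector_mult_def diag_matrix_def if_distrib [of "\<lambda>x. x * _"] cong: if_cong)

lemma diag_matrix_mult: "diag_matrix f ** diag_matrix g = diag_matrix (\<lambda>i. f i * g i)"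
  for f g :: "'n::finite \<Rightarrow> 'a::comm_ring_1"
  by (simp add: vec_eq_iff diag_matrix_mult_left) (simp add: diag_matrix_def)

lemma mat_eq_diag_matrix: "mat x = diag_matrix (\<lambda>_. x)"
  by (simp add: mat_def diag_matrix_def)

lemma matrix_mult_mat: "M ** mat x = mat x ** M" for M :: "'a::comm_ring_1^'n^'n"
  by (simp add: vec_eq_iff mat_eq_diag_matrix diag_matrix_mult_left diag_matrix_mult_right
      mult.commute)

lemma charpoly_similar:
  fixes A P P' :: "'a::comm_ring_1^'n^'n"
  assumes "P ** P' = mat 1"
  shows "charpoly (P ** A ** P') = charpoly A"
proof -
  \<comment> \<open>Embedding matrices as constant polynomial matrices is multiplicative, and the
    scalar matrix X is central, so conjugation passes through X - A before determinants are
    taken.\<close>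
  define C where "C = (\<lambda>M :: 'a^'n^'n. (\<chi> i j. [:M $ i $ j:]) :: 'a poly^'n^'n)"
  have const_sum: "(\<Sum>i\<in>S. [:f i:]) = [:\<Sum>i\<in>S. f i:]" for f :: "'n \<Rightarrow> 'a" and S
    by (induction S rule: infinite_finite_induct) auto
  have C_mult: "C (M ** N) = C M ** C N" for M N
    by (simp add: C_def matrix_matrix_mult_def vec_eq_iff const_sum mult.commute)
  have C_1: "C P ** C P' = mat 1"
    unfolding C_mult [symmetric] assms by (simp add: C_def mat_def vec_eq_iff)
  have charpoly: "charpoly M = det (mat [:0, 1:] - C M)" for M :: "'a^'n^'n"
    unfolding charpoly_def C_def
    by (rule arg_cong [of _ _ det]) (simp add: vec_eq_iff mat_def)
  have "C P ** (mat [:0, 1:] - C A) ** C P' = mat [:0, 1:] ** (C P ** C P') - C (P ** A ** P')"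
    by (simp add: matrix_mult_diff_left matrix_mult_diff_right C_mult matrix_mult_mat matrix_mul_assoc)
  then have "charpoly (P ** A ** P') = det (C P ** (mat [:0, 1:] - C A) ** C P')"
    by (simp add: charpoly C_1)
  also have "\<dots> = det (C P ** C P') * charpoly A"
    by (simp add: det_mul charpoly)
  finally show ?thesis
    by (simp add: C_1)
qed

lemma charpoly_diag: "charpoly (diag_matrix d) = (\<Prod>i\<in>UNIV. [:- d i, 1:])"
  unfolding charpoly_def
  by (subst det_diagonal) (auto simp: diag_matrix_def)

lemma order_prod_linear:
  "finite S \<Longrightarrow> order c (\<Prod>i\<in>S. [:- d i, 1:]) = card {i\<in>S. d i = (c :: 'a::field)}"
proof (induction S rule: finite_induct)
  case (insert x S)
  have "order c [:- d x, 1:] = (if d x = c then 1 else 0)"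
    using order_power_n_n [of "d x" 1] by (auto intro!: order_0I)
  moreover have "{i \<in> insert x S. d i = c} = (if d x = c then insert x {i \<in> S. d i = c} else {i \<in> S. d i = c})"
    by auto
  moreover have "[:- d x, 1:] * (\<Prod>i\<in>S. [:- d i, 1:]) \<noteq> 0"
    using insert by (simp del: mult_pCons_left)
  ultimately show ?case
    using insert by (simp add: order_mult del: mult_pCons_left)
qed auto

lemma eigenvalues_similar:
  fixes A P P' :: "'a::field^'n^'n"
  assumes "P ** P' = mat 1"
  shows "eigenvalues (P ** A ** P') = eigenvalues A"
proof -
  have *: "P' ** P = mat 1"
    using assms matrix_left_right_inverse by blast
  \<comment> \<open>One inclusion for all inverse pairs is enough: conjugating back by the inverse
    pair gives the other one.\<close>
  have "eigenvalues A \<subseteq> eigenvalues (P ** A ** P')" if "P' ** P = mat 1" for A P P' :: "'a^'n^'n"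
  proof
    fix c assume "c \<in> eigenvalues A"
    then obtain v where v: "v \<noteq> 0" "A *v v = c *s v"
      by (auto simp: eigenvalues_def)
    have P: "P' *v (P *v v) = v"
      by (simp add: matrix_vector_mul_assoc that)
    then have "P *v v \<noteq> 0"
      using v by auto
    moreover have "(P ** A ** P') *v (P *v v) = c *s (P *v v)"
      by (metis P matrix_vector_mul_assoc v(2) vec.scale)
    ultimately show "c \<in> eigenvalues (P ** A ** P')"
      by (auto simp: eigenvalues_def)
  qed
  from this [OF *] this [OF assms, of "P ** A ** P'"] show ?thesis
    using * assms by (simp add: set_eq_subset flip: matrix_mul_assoc) (simp add: matrix_mul_assoc)
qed

lemma eigenvalues_diag: "eigenvalues (diag_matrix d) = range d" for d :: "'n::finite \<Rightarrow> 'a::field"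
proof (intro set_eqI iffI)
  fix c assume "c \<in> eigenvalues (diag_matrix d)"
  then obtain v where v: "v \<noteq> 0" "diag_matrix d *v v = c *s v"
    by (auto simp: eigenvalues_def)
  then obtain i where "v $ i \<noteq> 0"
    by (auto simp: vec_eq_iff)
  moreover have "d i * v $ i = c * v $ i"
    using v(2) by (metis diag_matrix_mult_vec vector_smult_component)
  ultimately show "c \<in> range d" by auto
next
  fix c assume "c \<in> range d"
  then obtain i where "c = d i" by auto
  then have "diag_matrix d *v axis i 1 = c *s axis i 1"
    by (auto simp: vec_eq_iff diag_matrix_mult_vec axis_def)
  then show "c \<in> eigenvalues (diag_matrix d)"
    by (auto simp: eigenvalues_def intro!: exI [of _ "axis i 1"])
qed

lemma unitary_diag_hermitian:
  "Q ** diag_matrix (\<lambda>a. complex_of_real (d a)) ** adjoint_matrix Q \<in> hermitian_matrices"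
  by (simp add: hermitian_matrices_def adjoint_matrix_mult adjoint_matrix_diag matrix_mul_assoc)

text \<open>Reduces membership to counting the fibres of a function on the index set. Both bounds
  enter and leave the set of matrices through this equivalence.\<close>

lemma unitary_diag_in_hermitian_with_multiplicities_iff:
  fixes Q :: "complex^'n^'n" and d :: "'n::finite \<Rightarrow> real"
  defines "\<delta> \<equiv> \<lambda>a. complex_of_real (d a)"
  assumes "unitary_matrix Q"
  shows "Q ** diag_matrix \<delta> ** adjoint_matrix Q \<in> hermitian_with_multiplicities I k \<longleftrightarrow>
    (\<exists>c. bij_betw c {1..I} (range \<delta>) \<and> (\<forall>i\<in>{1..I}. card {a. \<delta> a = c i} = k i))"
proof -
  have Q: "Q ** adjoint_matrix Q = mat 1"
    using assms by (simp add: unitary_matrix_right)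
  have "eigenvalues (Q ** diag_matrix \<delta> ** adjoint_matrix Q) = range \<delta>"
    by (simp add: eigenvalues_similar [OF Q] eigenvalues_diag)
  moreover have "multiplicity_eigenvalue (Q ** diag_matrix \<delta> ** adjoint_matrix Q) c =
      card {a. \<delta> a = c}" for c
    by (simp add: multiplicity_eigenvalue_def charpoly_similar [OF Q] charpoly_diag
        order_prod_linear)
  ultimately show ?thesis
    using unitary_diag_hermitian [of Q d]
    by (auto simp: hermitian_with_multiplicities_def \<delta>_def)
qed

section \<open>Unitary diagonalization of hermitian matrices\<close>

text \<open>A maximiser of the quadratic form on the unit sphere of \<open>X\<close> is an eigenvector.\<close>

lemma symmetric_eigenvector_exists:
  fixes f :: "'a::euclidean_space \<Rightarrow> 'a"
  assumes "linear f" and sym: "\<And>x y. f x \<bullet> y = x \<bullet> f y"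
    and X: "subspace X" "\<And>x. x \<in> X \<Longrightarrow> f x \<in> X" and "u \<in> X" "u \<noteq> 0"
  obtains v l where "v \<in> X" "norm v = 1" "f v = l *\<^sub>R v"
proof -
  interpret linear f by fact
  define S where "S = X \<inter> sphere 0 1"
  have "compact S"
    unfolding S_def by (intro closed_Int_compact closed_subspace X compact_sphere)
  moreover have "u /\<^sub>R norm u \<in> S"
    using assms by (simp add: S_def subspace_scale)
  moreover have "continuous_on S (\<lambda>x. f x \<bullet> x)"
    by (intro continuous_intros linear_continuous_on linear_conv_bounded_linear [THEN iffD1]) fact
  ultimately obtain v where v: "v \<in> S" and max: "\<And>x. x \<in> S \<Longrightarrow> f x \<bullet> x \<le> f v \<bullet> v"
    using continuous_attains_sup [of S "\<lambda>x. f x \<bullet> x"] by blast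
  define l where "l = f v \<bullet> v"
  have vX: "v \<in> X" and nv: "norm v = 1"
    using v by (auto simp: S_def)
  then have vv: "v \<bullet> v = 1"
    by (simp add: norm_eq_1)
  have q_le: "f x \<bullet> x \<le> l * (x \<bullet> x)" if "x \<in> X" for x
  proof (cases "x = 0")
    case False
    then have "x /\<^sub>R norm x \<in> S"
      using that X by (simp add: S_def subspace_scale)
    from max [OF this] have "(f x \<bullet> x) / (norm x * norm x) \<le> l"
      by (simp add: scale l_def field_simps)
    then show ?thesis
      using False by (simp add: divide_le_eq dot_square_norm power2_eq_square)
  qed (simp add: zero)
  \<comment> \<open>The residual r is the component of \<open>f v\<close> orthogonal to v. Testing
    the maximality of v at v + t r gives a first-order gain 2 t (r . r) against quadratic terms
    collected in \<open>C\<close>; letting t tend to 0 forces r = 0.\<close>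
  define r where "r = f v - l *\<^sub>R v"
  define C where "C = l * (r \<bullet> r) - f r \<bullet> r"
  have rX: "r \<in> X"
    using vX X by (simp add: r_def subspace_diff subspace_scale)
  have "2 * (r \<bullet> r) \<le> t * C" if "t > 0" for t
  proof -
    have le: "f (v + t *\<^sub>R r) \<bullet> (v + t *\<^sub>R r) \<le> l * ((v + t *\<^sub>R r) \<bullet> (v + t *\<^sub>R r))"
      using vX rX X by (intro q_le subspace_add subspace_scale)
    have lhs: "f (v + t *\<^sub>R r) \<bullet> (v + t *\<^sub>R r) = l + 2 * t * (f v \<bullet> r) + t\<^sup>2 * (f r \<bullet> r)"
      using sym [of r v] by (simp add: add scale l_def inner_add_left inner_add_right
          inner_commute power2_eq_square algebra_simps)
    have rhs: "(v + t *\<^sub>R r) \<bullet> (v + t *\<^sub>R r) = 1 + 2 * t * (v \<bullet> r) + t\<^sup>2 * (r \<bullet> r)"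
      by (simp add: vv inner_add_left inner_add_right inner_commute power2_eq_square algebra_simps)
    have fv: "f v \<bullet> r = r \<bullet> r + l * (v \<bullet> r)"
      by (simp add: r_def inner_diff_left inner_diff_right inner_commute algebra_simps)
    have "t * (2 * (r \<bullet> r)) \<le> t * (t * C)"
      using le unfolding lhs rhs fv by (simp add: C_def algebra_simps power2_eq_square)
    then show ?thesis
      using that by simp
  qed
  then have "2 * (r \<bullet> r) \<le> 0"
  proof -
    assume *: "\<And>t. 0 < t \<Longrightarrow> 2 * (r \<bullet> r) \<le> t * C"
    have "((\<lambda>t. t * C) \<longlongrightarrow> 0 * C) (at_right 0)"
      by (intro tendsto_intros)
    moreover have "\<forall>\<^sub>F t in at_right 0. 2 * (r \<bullet> r) \<le> t * C"
      using * by (auto simp: eventually_at_right_less eventually_at_filter)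
    ultimately show ?thesis
      by (intro tendsto_lowerbound [of _ _ "at_right (0::real)"]) auto
  qed
  then have "r = 0"
    by (smt (verit) inner_eq_zero_iff inner_ge_zero)
  then show ?thesis
    using that vX nv by (simp add: r_def)
qed

section \<open>Complex inner product and orthonormal eigenbases\<close>

definition hermitian_product :: "complex^'n \<Rightarrow> complex^'n \<Rightarrow> complex"
  where "hermitian_product x y = (\<Sum>i\<in>UNIV. x $ i * cnj (y $ i))"

lemma inner_eq_Re_hermitian_product: "x \<bullet> y = Re (hermitian_product x y)"
  by (simp add: hermitian_product_def inner_vec_def inner_complex_def)

text \<open>The inner product of the type is only the real part of the hermitian one; pairing with
  \<i> y recovers the imaginary part. Complex orthogonality thus becomes two real orthogonality
  conditions.\<close>

lemma hermitian_product_eq: "hermitian_product x y = Complex (x \<bullet> y) (x \<bullet> (\<i> *s y))"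
  by (simp add: complex_eq_iff inner_eq_Re_hermitian_product)
    (simp add: hermitian_product_def)

lemma hermitian_product_commute: "hermitian_product y x = cnj (hermitian_product x y)"
  by (simp add: hermitian_product_def mult.commute)

text \<open>Induction over subsets of the index type, so that the eigenvectors are indexed by matrix
  columns from the start. A new eigenvector is found in the orthogonal complement of the old ones,
  which A preserves.\<close>

lemma hermitian_orthonormal_eigenbasis:
  fixes A :: "complex^'n^'n" and S :: "'n set"
  assumes A: "adjoint_matrix A = A"
  shows "\<exists>q d. (\<forall>a\<in>S. \<forall>b\<in>S. hermitian_product (q a) (q b) = (if a = b then 1 else 0)) \<and>
    (\<forall>a\<in>S. A *v q a = complex_of_real (d a) *s q a)"
  using finite [of S]
proof (induction S rule: finite_induct)
  case empty
  then show ?case by simp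
next
  case (insert s S)
  then obtain q d where
    orth: "\<And>a b. a \<in> S \<Longrightarrow> b \<in> S \<Longrightarrow> hermitian_product (q a) (q b) = (if a = b then 1 else 0)"
    and eig: "\<And>a. a \<in> S \<Longrightarrow> A *v q a = complex_of_real (d a) *s q a"
    by blast
  \<comment> \<open>Including the multiples by \<i> makes the real orthogonal complement of B the
    complex one of the q a. At most 2 * card S vectors cannot span a space of real dimension 2n, so
    the complement is nonzero.\<close>
  define B where "B = q ` S \<union> (\<lambda>a. \<i> *s q a) ` S"
  define X where "X = {x. \<forall>y\<in>B. orthogonal y x}"
  have X: "x \<in> X \<longleftrightarrow> (\<forall>a\<in>S. hermitian_product x (q a) = 0)" for x
    by (auto simp: X_def B_def hermitian_product_eq orthogonal_def complex_eq_iff inner_commute)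
  have "card B \<le> 2 * card S"
    unfolding B_def using card_Un_le [of "q ` S" "(\<lambda>a. \<i> *s q a) ` S"]
      card_image_le [of S q] card_image_le [of S "\<lambda>a. \<i> *s q a"] by simp
  also have "\<dots> < 2 * CARD('n)"
    using insert psubset_card_mono [of UNIV S] by auto
  finally have "card B < DIM(complex^'n)"
    by simp
  then have "dim B < DIM(complex^'n)"
    by (rule le_less_trans [OF dim_le_card', rotated]) (simp add: B_def)
  then obtain u where u: "u \<noteq> 0" "\<And>y. y \<in> span B \<Longrightarrow> orthogonal u y"
    using orthogonal_to_subspace_exists [of B] by blast
  then have uX: "u \<in> X"
    by (auto simp: X_def orthogonal_commute span_base)
  have sub: "subspace X"
    unfolding X_def by (rule subspace_orthogonal_to_vectors)
  have inv: "A *v x \<in> X" if "x \<in> X" for x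
  proof -
    have "hermitian_product (A *v x) (q a) = complex_of_real (d a) * hermitian_product x (q a)"
      if "a \<in> S" for a
    proof -
      have "A *v (\<i> *s q a) = \<i> *s (A *v q a)"
        by (simp add: vec.scale)
      then show ?thesis
        unfolding hermitian_product_eq inner_adjoint_matrix A
        by (simp add: eig that complex_eq_iff inner_eq_Re_hermitian_product)
         (simp add: hermitian_product_def sum_distrib_left algebra_simps)
    qed
    with that show ?thesis by (simp add: X)
  qed
  have sym: "(A *v x) \<bullet> y = x \<bullet> (A *v y)" for x y
    by (simp add: inner_adjoint_matrix A)
  obtain v l where v: "v \<in> X" "norm v = 1" "A *v v = l *\<^sub>R v"
    by (rule symmetric_eigenvector_exists [OF matrix_vector_mul_linear sym sub inv uX u(1)])
  have vv: "hermitian_product v v = 1"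
    using v(2) by (simp add: complex_eq_iff hermitian_product_eq norm_eq_1)
      (simp add: inner_vec_def inner_complex_def)
  have vq: "hermitian_product v (q a) = 0" if "a \<in> S" for a
    using v(1) that X by simp
  have qv: "hermitian_product (q a) v = 0" if "a \<in> S" for a
    using vq [OF that] hermitian_product_commute [of "q a" v] by simp
  have Av: "A *v v = complex_of_real l *s v"
    by (simp only: v(3) vec_eq_iff vector_scaleR_component vector_smult_component)
      (simp add: scaleR_conv_of_real)
  define q' where "q' = q(s := v)"
  define d' where "d' = d(s := l)"
  have q': "q' s = v" "\<And>a. a \<in> S \<Longrightarrow> q' a = q a"
    and d': "d' s = l" "\<And>a. a \<in> S \<Longrightarrow> d' a = d a"
    using insert(2) by (auto simp: q'_def d'_def)
  have orth': "hermitian_product (q' a) (q' b) = (if a = b then 1 else 0)"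
    if "a \<in> insert s S" "b \<in> insert s S" for a b
  proof (cases "a = s")
    case True
    then show ?thesis
      using that insert(2) vv vq q' by (cases "b = s") auto
  next
    case False
    then show ?thesis
      using that insert(2) qv orth q' by (cases "b = s") auto
  qed
  have eig': "A *v q' a = complex_of_real (d' a) *s q' a" if "a \<in> insert s S" for a
    using that Av eig q' d' by (cases "a = s") auto
  show ?case
    by (rule exI [of _ q'], rule exI [of _ d'], intro conjI ballI orth' eig')
qed

lemma hermitian_unitary_diagonalization:
  fixes A :: "complex^'n^'n"
  assumes "A \<in> hermitian_matrices"
  obtains Q d where "unitary_matrix Q"
    "A = Q ** diag_matrix (\<lambda>a. complex_of_real (d a)) ** adjoint_matrix Q"
proof -
  obtain q :: "'n \<Rightarrow> complex^'n" and d where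
    orth: "\<And>a b. hermitian_product (q a) (q b) = (if a = b then 1 else 0)"
    and eig: "\<And>a. A *v q a = complex_of_real (d a) *s q a"
    using hermitian_orthonormal_eigenbasis [of A UNIV] assms
    unfolding hermitian_matrices_def mem_Collect_eq by (metis UNIV_I)
  define Q where "Q = (\<chi> i j. q j $ i)"
  have U: "unitary_matrix Q"
    using orth unfolding unitary_matrix_def
    by (auto simp: vec_eq_iff matrix_matrix_mult_def adjoint_matrix_def Q_def mat_def
        hermitian_product_def mult.commute)
  have "A ** Q = Q ** diag_matrix (\<lambda>a. complex_of_real (d a))"
    using eig unfolding vec_eq_iff diag_matrix_mult_right
    by (simp add: matrix_matrix_mult_def matrix_vector_mult_def Q_def mult.commute)
  then have "A = Q ** diag_matrix (\<lambda>a. complex_of_real (d a)) ** adjoint_matrix Q"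
    by (metis U matrix_mul_assoc matrix_mul_rid unitary_matrix_right)
  with U show ?thesis using that by blast
qed

section \<open>The tangent space and its dimension\<close>

text \<open>The candidate tangent space at a diagonal matrix whose equal entries are those with
  equal labels. Labels have an arbitrary type because they are real eigenvalues in the upper bound,
  natural numbers in the lower bound, and the indices themselves when all hermitian matrices are
  wanted.\<close>

definition block_tangent :: "('n \<Rightarrow> 'c) \<Rightarrow> (complex^'n^'n) set"
  where "block_tangent \<beta> = {H \<in> hermitian_matrices. \<forall>a b. \<beta> a = \<beta> b \<longrightarrow>
    H $ a $ a = H $ b $ b \<and> (a \<noteq> b \<longrightarrow> H $ a $ b = 0)}"

lemma hermitian_matrices_iff: "H \<in> hermitian_matrices \<longleftrightarrow> (\<forall>a b. H $ b $ a = cnj (H $ a $ b))"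
  unfolding hermitian_matrices_def adjoint_matrix_def vec_eq_iff mem_Collect_eq vec_lambda_beta
  by metis

lemma subspace_hermitian_matrices: "subspace (hermitian_matrices :: (complex^'n^'n) set)"
  by (rule subspaceI)
    (simp_all add: hermitian_matrices_def linear_add [OF linear_adjoint_matrix]
      linear_scale [OF linear_adjoint_matrix] linear_0 [OF linear_adjoint_matrix])

lemma subspace_block_tangent: "subspace (block_tangent \<beta> :: (complex^'n^'n) set)"
proof -
  define X :: "(complex^'n^'n) set" where "X = {H. \<forall>a b. \<beta> a = \<beta> b \<longrightarrow>
    H $ a $ a = H $ b $ b \<and> (a \<noteq> b \<longrightarrow> H $ a $ b = 0)}"
  have "subspace X"
    unfolding X_def
  proof (rule subspaceI; unfold mem_Collect_eq; intro allI impI)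
    fix x y :: "complex^'n^'n" and a b
    assume *: "\<beta> a = \<beta> b"
      "\<forall>a b. \<beta> a = \<beta> b \<longrightarrow> x $ a $ a = x $ b $ b \<and> (a \<noteq> b \<longrightarrow> x $ a $ b = 0)"
      "\<forall>a b. \<beta> a = \<beta> b \<longrightarrow> y $ a $ a = y $ b $ b \<and> (a \<noteq> b \<longrightarrow> y $ a $ b = 0)"
    then have "x $ a $ a = x $ b $ b" "y $ a $ a = y $ b $ b"
      "a \<noteq> b \<Longrightarrow> x $ a $ b = 0" "a \<noteq> b \<Longrightarrow> y $ a $ b = 0"
      by blast+
    then show "(x + y) $ a $ a = (x + y) $ b $ b \<and> (a \<noteq> b \<longrightarrow> (x + y) $ a $ b = 0)"
      by simp
  next
    fix c :: real and x :: "complex^'n^'n" and a b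
    assume *: "\<beta> a = \<beta> b"
      "\<forall>a b. \<beta> a = \<beta> b \<longrightarrow> x $ a $ a = x $ b $ b \<and> (a \<noteq> b \<longrightarrow> x $ a $ b = 0)"
    then have "x $ a $ a = x $ b $ b" "a \<noteq> b \<Longrightarrow> x $ a $ b = 0"
      by blast+
    then show "(c *\<^sub>R x) $ a $ a = (c *\<^sub>R x) $ b $ b \<and> (a \<noteq> b \<longrightarrow> (c *\<^sub>R x) $ a $ b = 0)"
      by simp
  qed simp
  moreover have "block_tangent \<beta> = hermitian_matrices \<inter> X"
    unfolding block_tangent_def X_def by blast
  ultimately show ?thesis
    by (simp add: subspace_inter subspace_hermitian_matrices)
qed

lemma block_tangent_inj:
  assumes "inj \<beta>"
  shows "block_tangent \<beta> = hermitian_matrices"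
proof -
  have "a = b" if "\<beta> a = \<beta> b" for a b
    using that assms by (simp add: inj_eq)
  then show ?thesis
    unfolding block_tangent_def by blast
qed

text \<open>Real and imaginary parts of a hermitian matrix are its symmetric and antisymmetric
  components, so their sum, a real matrix, determines it. A block-scalar diagonal is recorded only
  at one representative \<open>\<rho> a\<close> of each block.\<close>

lemma dim_block_tangent:
  fixes \<beta> :: "'n::finite \<Rightarrow> 'c"
  shows "dim (block_tangent \<beta>) + card {(a, b). \<beta> a = \<beta> b} = CARD('n)\<^sup>2 + card (range \<beta>)"
proof -
  define \<rho> where "\<rho> a = (SOME b. \<beta> b = \<beta> a)" for a
  have \<beta>\<rho>: "\<beta> (\<rho> a) = \<beta> a" for a
    unfolding \<rho>_def by (rule someI) (rule refl)
  have \<rho>_eq: "\<beta> a = \<beta> b \<Longrightarrow> \<rho> a = \<rho> b" for a b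
    by (simp add: \<rho>_def)
  have \<rho>\<rho>: "\<rho> (\<rho> a) = \<rho> a" for a
    by (rule \<rho>_eq) (rule \<beta>\<rho>)
  define e :: "'n \<times> 'n \<Rightarrow> real^'n^'n" where "e = (\<lambda>(a, b). axis a (axis b 1))"
  \<comment> \<open>The free coordinates: all positions between different blocks, and one diagonal
    position for each block.\<close>
  define J where "J = {(a, b). \<beta> a \<noteq> \<beta> b} \<union> (\<lambda>a. (a, a)) ` range \<rho>"
  define N where "N = {x. \<forall>i\<in>Basis. i \<notin> e ` J \<longrightarrow> x \<bullet> i = 0}"
  define L :: "real^'n^'n \<Rightarrow> complex^'n^'n" where
    "L x = (\<chi> a b. if \<beta> a = \<beta> b then if a = b then complex_of_real (x $ \<rho> a $ \<rho> a) else 0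
       else Complex (x $ a $ b + x $ b $ a) (x $ a $ b - x $ b $ a))" for x
  have inj_e: "inj e"
    by (auto simp: e_def inj_on_def axis_eq_axis)
  have "range \<beta> = \<beta> ` range \<rho>"
    by (simp add: image_image \<beta>\<rho>)
  moreover have "inj_on \<beta> (range \<rho>)"
    by (auto simp: inj_on_def \<beta>\<rho> intro: \<rho>_eq)
  ultimately have "card (range \<beta>) = card (range \<rho>)"
    by (simp add: card_image)
  then have card_J: "card J = card {(a, b). \<beta> a \<noteq> \<beta> b} + card (range \<beta>)"
    unfolding J_def by (subst card_Un_disjoint) (auto simp: card_image inj_on_def)
  have "{(a, b). \<beta> a \<noteq> \<beta> b} \<union> {(a, b). \<beta> a = \<beta> b} = UNIV"
    by auto
  moreover have "{(a, b). \<beta> a \<noteq> \<beta> b} \<inter> {(a, b). \<beta> a = \<beta> b} = {}"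
    by auto
  ultimately have "card {(a, b). \<beta> a \<noteq> \<beta> b} + card {(a, b). \<beta> a = \<beta> b} = CARD('n \<times> 'n)"
    by (metis card_Un_disjoint finite)
  then have card_pairs: "card {(a, b). \<beta> a \<noteq> \<beta> b} + card {(a, b). \<beta> a = \<beta> b} = CARD('n)\<^sup>2"
    by (simp add: power2_eq_square)
  have Basis_e: "(Basis :: (real^'n^'n) set) = range e"
    by (auto simp: Basis_vec_def e_def)
  have inner_e: "x \<bullet> e (a, b) = x $ a $ b" for x a b
    by (simp add: e_def inner_axis)
  have "dim N = card (e ` J)"
    unfolding N_def by (rule dim_substandard) (auto simp: Basis_e)
  then have dim_N: "dim N = card J"
    using inj_e by (simp add: card_image inj_on_subset)
  have N: "x \<in> N \<longleftrightarrow> (\<forall>a b. (a, b) \<notin> J \<longrightarrow> x $ a $ b = 0)" for x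
    using inj_e by (auto simp: N_def Basis_e inner_e inj_image_mem_iff)
  have "subspace N"
    by (auto simp: subspace_def N)
  have lin: "linear L"
    by (rule linearI) (auto simp: L_def vec_eq_iff complex_eq_iff field_simps)
  have "inj_on L N"
  proof (rule linear_inj_on_iff_eq_0 [THEN iffD2, OF lin \<open>subspace N\<close>, rule_format])
    fix x assume x: "x \<in> N" "L x = 0"
    have "x $ a $ b = 0" if "(a, b) \<in> J" for a b
    proof (cases "\<beta> a = \<beta> b")
      case True
      then have "b = a" "\<rho> a = a"
        using that \<rho>\<rho> by (auto simp: J_def)
      moreover have "L x $ a $ a = 0"
        using x by simp
      ultimately show ?thesis
        by (simp add: L_def)
    next
      case False
      have "L x $ a $ b = 0"
        using x by simp
      with False show ?thesis
        by (simp add: L_def complex_eq_iff)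
    qed
    with x have "x $ a $ b = 0" for a b
      by (cases "(a, b) \<in> J") (auto simp: N)
    then show "x = 0"
      by (simp add: vec_eq_iff)
  qed
  moreover have "L ` N = block_tangent \<beta>"
  proof (intro equalityI subsetI)
    fix H assume "H \<in> L ` N"
    then obtain x where H: "H = L x"
      by blast
    have 1: "L x $ b $ a = cnj (L x $ a $ b)" for a b
    proof (cases "\<beta> a = \<beta> b")
      case False
      then have "\<beta> b \<noteq> \<beta> a"
        by simp
      with False show ?thesis
        by (simp add: L_def complex_eq_iff)
    qed (simp add: L_def)
    have 2: "L x $ a $ a = L x $ b $ b" if "\<beta> a = \<beta> b" for a b
      using \<rho>_eq [OF that] by (simp add: L_def)
    have 3: "L x $ a $ b = 0" if "\<beta> a = \<beta> b" "a \<noteq> b" for a b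
      using that by (simp add: L_def)
    show "H \<in> block_tangent \<beta>"
      unfolding block_tangent_def hermitian_matrices_iff H mem_Collect_eq
      using 1 2 3 by meson
  next
    fix H assume H: "H \<in> block_tangent \<beta>"
    then have herm: "H $ b $ a = cnj (H $ a $ b)" for a b
      unfolding block_tangent_def hermitian_matrices_iff by blast
    have diag: "H $ a $ a = H $ b $ b" if "\<beta> a = \<beta> b" for a b
      using H that unfolding block_tangent_def by blast
    have off: "H $ a $ b = 0" if "\<beta> a = \<beta> b" "a \<noteq> b" for a b
      using H that unfolding block_tangent_def by blast
    have real: "Im (H $ a $ a) = 0" for a
      using arg_cong [OF herm [of a a], of Im] by simp
    \<comment> \<open>Inverts \<open>L\<close>: off the blocks, Re = x_ab + x_ba and Im = x_ab -
      x_ba, so x_ab is half of Re + Im.\<close>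
    define x :: "real^'n^'n" where
      "x = (\<chi> a b. if (a, b) \<notin> J then 0 else if a = b then Re (H $ a $ a)
        else (Re (H $ a $ b) + Im (H $ a $ b)) / 2)"
    have "L x $ a $ b = H $ a $ b" for a b
    proof (cases "\<beta> a = \<beta> b")
      case True
      have "x $ \<rho> a $ \<rho> a = Re (H $ a $ a)"
        using diag [OF \<beta>\<rho>] real by (simp add: x_def J_def)
      with True show ?thesis
        using off real [of a] by (auto simp: L_def complex_eq_iff)
    next
      case False
      then have "x $ a $ b = (Re (H $ a $ b) + Im (H $ a $ b)) / 2"
        "x $ b $ a = (Re (H $ a $ b) - Im (H $ a $ b)) / 2"
        using herm [of a b] by (auto simp: x_def J_def)
      with False show ?thesis
        by (simp add: L_def complex_eq_iff field_simps)
    qed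
    then have "L x = H"
      by (simp add: vec_eq_iff)
    moreover have "x \<in> N"
      by (simp add: N x_def)
    ultimately show "H \<in> L ` N"
      by blast
  qed
  ultimately have "dim (block_tangent \<beta>) = dim N"
    using dim_image_eq [OF lin, of N] \<open>subspace N\<close> by (simp add: span_eq_iff [THEN iffD2])
  then show ?thesis
    using card_J card_pairs dim_N by linarith
qed

text \<open>The case of blocks of size one, where the count of equal pairs and the count of labels
  are both n and cancel.\<close>

lemma dim_hermitian_matrices: "dim (hermitian_matrices :: (complex^'n^'n) set) = CARD('n)\<^sup>2"
proof -
  have *: "{(a, b). a = (b :: 'n)} = (\<lambda>a. (a, a)) ` UNIV"
    by (rule set_eqI) (simp add: image_iff split_beta prod_eq_iff eq_commute)
  have card: "card {(a, b). a = (b :: 'n)} = CARD('n)"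
    unfolding * by (rule card_image) (simp add: inj_on_def)
  have tangent: "block_tangent (\<lambda>a :: 'n. a) = hermitian_matrices"
    by (rule block_tangent_inj) (simp add: inj_on_def)
  show ?thesis
    using dim_block_tangent [of "\<lambda>a :: 'n. a"] unfolding tangent card image_ident by simp
qed

text \<open>The pairs with equal labels form the disjoint union of the squares of the fibres; this
  is where the sum of the \<open>(k i)\<^sup>2\<close> comes from.\<close>

lemma card_pairs_same_fibre:
  fixes \<beta> :: "'n::finite \<Rightarrow> 'c"
  assumes c: "bij_betw c S (range \<beta>)"
  shows "card {(a, b). \<beta> a = \<beta> b} = (\<Sum>i\<in>S. (card {a. \<beta> a = c i})\<^sup>2)"
proof -
  have *: "\<exists>i\<in>S. c i = \<beta> a" for a
  proof -
    have "\<beta> a \<in> c ` S"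
      by (simp add: bij_betw_imp_surj_on [OF c])
    then show ?thesis by auto
  qed
  have "{(a, b). \<beta> a = \<beta> b} = (\<Union>i\<in>S. {a. \<beta> a = c i} \<times> {a. \<beta> a = c i})"
  proof (intro equalityI subsetI)
    fix p assume p: "p \<in> {(a, b). \<beta> a = \<beta> b}"
    obtain i where "i \<in> S" "c i = \<beta> (fst p)"
      using * by blast
    with p show "p \<in> (\<Union>i\<in>S. {a. \<beta> a = c i} \<times> {a. \<beta> a = c i})"
      by (intro UN_I [of i]) (auto simp: split_beta mem_Times_iff)
  qed auto
  moreover have "finite S"
    by (simp add: bij_betw_finite [OF c])
  ultimately have "card {(a, b). \<beta> a = \<beta> b} =
      (\<Sum>i\<in>S. card ({a. \<beta> a = c i} \<times> {a. \<beta> a = c i}))"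
    using bij_betw_imp_inj_on [OF c]
    by (simp only:, intro card_UN_disjoint) (auto simp: inj_on_def)
  then show ?thesis
    by (simp add: power2_eq_square)
qed

section \<open>Tangent vectors have scalar diagonal blocks\<close>

text \<open>g factors as h after f, and h maps the finite range of f onto a range of the same size,
  so it is injective. Applied with f the eigenvalues along the sequence and g their limits.\<close>

lemma finer_fibres_same_card:
  fixes f :: "'n::finite \<Rightarrow> 'a" and g :: "'n \<Rightarrow> 'b"
  assumes "\<And>a b. f a = f b \<Longrightarrow> g a = g b" "card (range f) = card (range g)" "g a = g b"
  shows "f a = f b"
proof -
  define h where "h y = g (SOME a. f a = y)" for y
  have h: "h (f a) = g a" for a
    unfolding h_def by (rule assms(1)) (rule someI, rule refl)
  have "h ` range f = range g"
    by (simp add: image_image h)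
  then have "inj_on h (range f)"
    using assms(2) by (intro eq_card_imp_inj_on) auto
  then show ?thesis
    using assms(3) inj_onD [of h "range f" "f a" "f b"] by (simp add: h)
qed

section \<open>Boundedness of the unitary group\<close>

lemma norm_matrix_le_of_entries:
  fixes A :: "complex^'n^'n"
  assumes "\<And>i j. norm (A $ i $ j) \<le> 1"
  shows "norm A \<le> real CARD('n) * real CARD('n)"
proof -
  have row: "norm (A $ i) \<le> real CARD('n)" for i
  proof -
    have "norm (A $ i) \<le> (\<Sum>j\<in>UNIV. norm (A $ i $ j))"
      unfolding norm_vec_def by (rule L2_set_le_sum) simp
    also have "\<dots> \<le> real CARD('n)"
      using sum_bounded_above [of UNIV "\<lambda>j. norm (A $ i $ j)" 1] assms by simp
    finally show ?thesis .
  qed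
  have "norm A \<le> (\<Sum>i\<in>UNIV. norm (A $ i))"
    unfolding norm_vec_def [of A] by (rule L2_set_le_sum) simp
  also have "\<dots> \<le> real CARD('n) * real CARD('n)"
    using sum_bounded_above [of UNIV "\<lambda>i. norm (A $ i)" "real CARD('n)"] row by simp
  finally show ?thesis .
qed

lemma bounded_unitary_matrices: "bounded {Q :: complex^'n^'n. unitary_matrix Q}"
proof -
  have "norm (Q $ i $ j) \<le> 1" if "unitary_matrix Q" for Q :: "complex^'n^'n" and i j
  proof -
    have "(adjoint_matrix Q ** Q) $ j $ j = 1"
      using that by (simp add: unitary_matrix_def mat_def)
    moreover have "(adjoint_matrix Q ** Q) $ j $ j = of_real (\<Sum>k\<in>UNIV. (norm (Q $ k $ j))\<^sup>2)"
      by (simp add: matrix_matrix_mult_def adjoint_matrix_def complex_norm_square mult.commute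
          del: of_real_power)
    ultimately have "(\<Sum>k\<in>UNIV. (norm (Q $ k $ j))\<^sup>2) = 1"
      using of_real_eq_1_iff by metis
    moreover have "(norm (Q $ i $ j))\<^sup>2 \<le> (\<Sum>k\<in>UNIV. (norm (Q $ k $ j))\<^sup>2)"
      by (rule member_le_sum) auto
    ultimately show ?thesis
      by (simp add: power_le_one_iff abs_le_square_iff [of _ 1, simplified])
  qed
  then show ?thesis
    unfolding bounded_iff
    by (intro exI [of _ "real CARD('n) * real CARD('n)"] ballI norm_matrix_le_of_entries) simp
qed

lemmas tendsto_matrix_mult = bounded_bilinear.tendsto [OF bounded_bilinear_matrix_mult]

lemma tendsto_adjoint_matrix:
  fixes X :: "'a \<Rightarrow> complex^'n^'n"
  shows "(X \<longlongrightarrow> A) F \<Longrightarrow> ((\<lambda>n. adjoint_matrix (X n)) \<longlongrightarrow> adjoint_matrix A) F"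
  using bounded_linear.tendsto [OF linear_adjoint_matrix [unfolded linear_conv_bounded_linear]] .

text \<open>By compactness the unitary diagonalizers of \<open>B n\<close> subconverge. As the number of distinct
  eigenvalues is constant, each eigenvalue of the limit is approached by a single eigenvalue of
  \<open>B n\<close>, and \<open>G\<close> below is the corresponding spectral projection.\<close>

lemma derivative_in_block_tangent:
  fixes d :: "'n::finite \<Rightarrow> real" and B :: "nat \<Rightarrow> complex^'n^'n"
  defines "D \<equiv> diag_matrix (\<lambda>a. complex_of_real (d a))"
  assumes B: "\<And>n. B n \<in> hermitian_matrices" "\<And>n. card (eigenvalues (B n)) = card (range d)"
    and t: "t \<longlonglongrightarrow> 0" "\<And>n. t n \<noteq> 0"
    and H: "(\<lambda>n. (B n - D) /\<^sub>R t n) \<longlonglongrightarrow> H"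
  shows "H \<in> block_tangent d"
proof -
  have "(\<lambda>n. D + t n *\<^sub>R ((B n - D) /\<^sub>R t n)) \<longlonglongrightarrow> D + 0 *\<^sub>R H"
    by (intro tendsto_intros t H)
  then have B_lim: "B \<longlonglongrightarrow> D"
    using t(2) by simp
  have "\<exists>Q e. unitary_matrix Q \<and>
      B n = Q ** diag_matrix (\<lambda>a. complex_of_real (e a)) ** adjoint_matrix Q" for n
    using hermitian_unitary_diagonalization [OF B(1) [of n]] by metis
  then obtain Q e where Q: "\<And>n. unitary_matrix (Q n)" and
    B_eq: "\<And>n. B n = Q n ** diag_matrix (\<lambda>a. complex_of_real (e n a)) ** adjoint_matrix (Q n)"
    by metis
  have card_e: "card (range (e n)) = card (range d)" for n
  proof -
    have "eigenvalues (B n) = complex_of_real ` range (e n)"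
      by (simp add: B_eq eigenvalues_similar [OF unitary_matrix_right [OF Q]] eigenvalues_diag
          image_image)
    then show ?thesis
      using B(2) [of n] by (simp add: card_image inj_on_def)
  qed
  have "bounded (range Q)"
    using bounded_subset [OF bounded_unitary_matrices] Q by blast
  then obtain P r where r: "strict_mono r" and P_lim: "(\<lambda>n. Q (r n)) \<longlonglongrightarrow> P"
    using bounded_imp_convergent_subsequence [of Q] by (auto simp: o_def)
  have Br_lim: "(\<lambda>n. B (r n)) \<longlonglongrightarrow> D"
    using LIMSEQ_subseq_LIMSEQ [OF B_lim r] by (simp add: o_def)
  have "(\<lambda>n. adjoint_matrix (Q (r n)) ** Q (r n)) \<longlonglongrightarrow> adjoint_matrix P ** P"
    by (intro tendsto_matrix_mult tendsto_adjoint_matrix P_lim)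
  then have P: "unitary_matrix P"
    unfolding unitary_matrix_def unitary_matrix_left [OF Q] using LIMSEQ_const_iff by metis
  define E where "E n = diag_matrix (\<lambda>a. complex_of_real (e (r n) a))" for n
  have E_eq: "E n = adjoint_matrix (Q (r n)) ** B (r n) ** Q (r n)" for n
    unfolding E_def B_eq using unitary_matrix_left [OF Q]
    by (metis matrix_mul_assoc matrix_mul_lid matrix_mul_rid)
  define \<Lambda> where "\<Lambda> = adjoint_matrix P ** D ** P"
  have E_lim: "E \<longlonglongrightarrow> \<Lambda>"
    unfolding E_eq \<Lambda>_def by (intro tendsto_matrix_mult tendsto_adjoint_matrix P_lim Br_lim)
  \<comment> \<open>A limit of real diagonal matrices is real and diagonal, so these entries
    determine \<Lambda>.\<close>
  define l where "l a = Re (\<Lambda> $ a $ a)" for a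
  have l_lim: "(\<lambda>n. e (r n) a) \<longlonglongrightarrow> l a" for a
    using tendsto_Re [OF tendsto_vec_nth [OF tendsto_vec_nth [OF E_lim, of a], of a]]
    by (simp add: E_def diag_matrix_def l_def)
  have "E \<longlonglongrightarrow> diag_matrix (\<lambda>a. complex_of_real (l a))"
    unfolding E_def diag_matrix_def
    by (intro vec_tendstoI) (auto intro!: tendsto_intros l_lim)
  then have \<Lambda>: "\<Lambda> = diag_matrix (\<lambda>a. complex_of_real (l a))"
    using E_lim LIMSEQ_unique by blast
  have DP: "D ** P = P ** \<Lambda>"
    unfolding \<Lambda>_def using unitary_matrix_right [OF P] by (simp add: matrix_mul_assoc)
  have P_zero: "P $ a $ c = 0" if "d a \<noteq> l c" for a c
  proof -
    have "(D ** P) $ a $ c = (P ** \<Lambda>) $ a $ c"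
      by (simp add: DP)
    then have "complex_of_real (d a) * P $ a $ c = P $ a $ c * complex_of_real (l c)"
      unfolding D_def \<Lambda> diag_matrix_mult_left diag_matrix_mult_right .
    then show ?thesis
      using that by (simp add: mult.commute)
  qed
  have "D = P ** \<Lambda> ** adjoint_matrix P"
    by (metis DP P matrix_mul_assoc matrix_mul_rid unitary_matrix_right)
  then have "eigenvalues D = eigenvalues \<Lambda>"
    by (simp add: eigenvalues_similar [OF unitary_matrix_right [OF P]])
  then have "complex_of_real ` range d = complex_of_real ` range l"
    by (simp add: D_def \<Lambda> eigenvalues_diag image_image)
  then have range_l: "range l = range d"
    by (simp add: inj_image_eq_iff inj_of_real)
  \<comment> \<open>Distinct limits eventually separate the eigenvalues, so the fibres of e refine
    those of l. Since both functions take the same number of values, the fibres coincide and no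
    limit eigenvalue splits.\<close>
  have ev_e: "\<forall>\<^sub>F n in sequentially. \<forall>a b. l a = l b \<longrightarrow> e (r n) a = e (r n) b"
  proof -
    have "\<forall>\<^sub>F n in sequentially. l a \<noteq> l b \<longrightarrow> e (r n) a \<noteq> e (r n) b" for a b
    proof (cases "l a = l b")
      case False
      have "(\<lambda>n. e (r n) a - e (r n) b) \<longlonglongrightarrow> l a - l b"
        by (intro tendsto_intros l_lim)
      then have "\<forall>\<^sub>F n in sequentially. e (r n) a - e (r n) b \<noteq> 0"
        using False by (intro tendsto_imp_eventually_ne) auto
      then show ?thesis
        by (rule eventually_mono) auto
    qed auto
    then have "\<forall>\<^sub>F n in sequentially. \<forall>a b. l a \<noteq> l b \<longrightarrow> e (r n) a \<noteq> e (r n) b"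
      by (simp add: eventually_all_finite)
    then show ?thesis
    proof (rule eventually_mono, intro allI impI)
      fix n a b
      assume "\<forall>a b. l a \<noteq> l b \<longrightarrow> e (r n) a \<noteq> e (r n) b" "l a = l b"
      then show "e (r n) a = e (r n) b"
        by (intro finer_fibres_same_card [of "e (r n)" l]) (auto simp: card_e range_l)
    qed
  qed
  define X where "X n = (B (r n) - D) /\<^sub>R t (r n)" for n
  have X_lim: "X \<longlonglongrightarrow> H"
    unfolding X_def using LIMSEQ_subseq_LIMSEQ [OF H r] by (simp add: o_def)
  have block: "H $ a $ a = H $ b $ b \<and> (a \<noteq> b \<longrightarrow> H $ a $ b = 0)" if ab: "d a = d b" for a b
  proof -
    have "d b \<in> range l"
      by (simp add: range_l)
    then obtain c0 where c0: "l c0 = d b"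
      by auto
    \<comment> \<open>Selects the eigenvectors of \<open>B (r n)\<close> whose eigenvalues tend to d
      b. Eventually all of these eigenvalues equal \<open>e (r n) c0\<close>, and \<mu> is the
      difference quotient of that common value.\<close>
    define J :: "complex^'n^'n" where "J = diag_matrix (\<lambda>c. if l c = d b then 1 else 0)"
    define G where "G n = Q (r n) ** J ** adjoint_matrix (Q (r n))" for n
    define \<mu> where "\<mu> n = complex_of_real ((e (r n) c0 - d b) / t (r n))" for n
    have G_lim: "G \<longlonglongrightarrow> P ** J ** adjoint_matrix P"
      unfolding G_def
      by (intro tendsto_matrix_mult tendsto_adjoint_matrix P_lim tendsto_const)
    \<comment> \<open>Row j of P is supported on the indices c with l c = d j. If d j = d b, the
      cut-off by J therefore loses nothing, and the entry is that of P P* = 1.\<close>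
    have PJP: "(P ** J ** adjoint_matrix P) $ i $ j = (if i = j then 1 else 0)"
      if "d j = d b" for i j
    proof -
      have "(P ** J ** adjoint_matrix P) $ i $ j = (\<Sum>c\<in>UNIV. (P ** J) $ i $ c * cnj (P $ j $ c))"
        by (simp add: matrix_matrix_mult_def adjoint_matrix_def)
      also have "\<dots> = (\<Sum>c\<in>UNIV. P $ i $ c * cnj (P $ j $ c))"
        unfolding J_def diag_matrix_mult_right
        using P_zero [of j] that by (intro sum.cong) auto
      also have "\<dots> = (P ** adjoint_matrix P) $ i $ j"
        by (simp add: matrix_matrix_mult_def adjoint_matrix_def)
      finally show ?thesis
        by (simp add: unitary_matrix_right [OF P] mat_def)
    qed
    have "\<forall>\<^sub>F n in sequentially. \<forall>i j. d i = d b \<longrightarrow> (X n ** G n) $ i $ j = \<mu> n * G n $ i $ j"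
      using ev_e
    proof (rule eventually_mono, intro allI impI)
      fix n i j
      assume e: "\<forall>a b. l a = l b \<longrightarrow> e (r n) a = e (r n) b" and i: "d i = d b"
      have "B (r n) ** G n = Q (r n) ** (E n ** J) ** adjoint_matrix (Q (r n))"
        unfolding G_def B_eq E_def [symmetric] using unitary_matrix_left [OF Q]
        by (metis matrix_mul_assoc matrix_mul_rid)
      also have "E n ** J = mat (complex_of_real (e (r n) c0)) ** J"
      proof -
        have "e (r n) c = e (r n) c0" if "l c = d b" for c
          using e c0 that by metis
        then show ?thesis
          unfolding E_def J_def mat_eq_diag_matrix diag_matrix_mult
          by (intro arg_cong [of _ _ diag_matrix] ext) simp
      qed
      also have "Q (r n) ** (mat (complex_of_real (e (r n) c0)) ** J) ** adjoint_matrix (Q (r n)) =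
          mat (complex_of_real (e (r n) c0)) ** G n"
        by (simp add: G_def matrix_mul_assoc matrix_mult_mat)
      finally have "(B (r n) ** G n) $ i $ j = complex_of_real (e (r n) c0) * G n $ i $ j"
        by (simp add: mat_eq_diag_matrix diag_matrix_mult_left)
      \<comment> \<open>On a row of the block of b, D multiplies by the number d b and can be
        subtracted from the eigenvalue; this is why only such rows are considered.\<close>
      moreover have "(D ** G n) $ i $ j = complex_of_real (d b) * G n $ i $ j"
        unfolding D_def diag_matrix_mult_left i ..
      moreover have "(X n ** G n) $ i $ j =
          ((B (r n) ** G n) $ i $ j - (D ** G n) $ i $ j) / complex_of_real (t (r n))"
      proof -
        have "X n ** G n = (B (r n) ** G n - D ** G n) /\<^sub>R t (r n)"
          by (simp only: X_def matrix_mult_diff_left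
              bounded_bilinear.scaleR_left [OF bounded_bilinear_matrix_mult])
        then show ?thesis
          by (simp only: vector_scaleR_component vector_minus_component)
            (simp add: scaleR_conv_of_real field_simps)
      qed
      ultimately show "(X n ** G n) $ i $ j = \<mu> n * G n $ i $ j"
        by (simp add: \<mu>_def field_simps)
    qed
    then have ev: "\<forall>\<^sub>F n in sequentially. (X n ** G n) $ i $ j = \<mu> n * G n $ i $ j"
      if "d i = d b" for i j
      by (rule eventually_mono) (use that in blast)
    have XG: "(\<lambda>n. (X n ** G n) $ i $ j) \<longlonglongrightarrow> H $ i $ j" if "d j = d b" for i j
    proof -
      have "(\<lambda>n. (X n ** G n) $ i $ j) \<longlonglongrightarrow> (H ** (P ** J ** adjoint_matrix P)) $ i $ j"
        by (intro tendsto_intros tendsto_matrix_mult X_lim G_lim)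
      also have "(H ** (P ** J ** adjoint_matrix P)) $ i $ j = H $ i $ j"
        unfolding matrix_matrix_mult_def [of H] using PJP [OF that]
        by (simp add: if_distrib [of "(*) _"] cong: if_cong)
      finally show ?thesis .
    qed
    have \<mu>G: "(\<lambda>n. \<mu> n * G n $ i $ j) \<longlonglongrightarrow> H $ i $ j" if "d i = d b" "d j = d b" for i j
      using Lim_transform_eventually [OF XG ev] that by blast
    have G: "(\<lambda>n. G n $ i $ j) \<longlonglongrightarrow> (if i = j then 1 else 0)" if "d j = d b" for i j
      using tendsto_vec_nth [OF tendsto_vec_nth [OF G_lim, of i], of j] PJP [OF that] by simp
    \<comment> \<open>Convergence of \<mu> is not known beforehand. It follows by dividing by a
      diagonal entry of G, which tends to 1; any i in the block gives the same limit, so the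
      diagonal of H is constant there.\<close>
    have \<mu>: "\<mu> \<longlonglongrightarrow> H $ i $ i" if "d i = d b" for i
    proof -
      have G1: "(\<lambda>n. G n $ i $ i) \<longlonglongrightarrow> 1"
        using G [OF that, of i] by simp
      have "(\<lambda>n. \<mu> n * G n $ i $ i / G n $ i $ i) \<longlonglongrightarrow> H $ i $ i / 1"
        by (intro tendsto_divide \<mu>G that G1) simp
      moreover have "\<forall>\<^sub>F n in sequentially. G n $ i $ i \<noteq> 0"
        using G1 by (rule tendsto_imp_eventually_ne) simp
      then have "\<forall>\<^sub>F n in sequentially. \<mu> n * G n $ i $ i / G n $ i $ i = \<mu> n"
        by (rule eventually_mono) simp
      ultimately show ?thesis
        using Lim_transform_eventually by fastforce
    qed
    have "H $ a $ a = H $ b $ b"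
      using LIMSEQ_unique [OF \<mu> \<mu>] ab by blast
    moreover have "H $ a $ b = 0" if "a \<noteq> b"
    proof -
      have "(\<lambda>n. \<mu> n * G n $ a $ b) \<longlonglongrightarrow> H $ b $ b * 0"
        using G [of b a] that by (intro tendsto_mult \<mu>) auto
      then show ?thesis
        using LIMSEQ_unique [OF \<mu>G [of a b]] ab by fastforce
    qed
    ultimately show ?thesis
      by blast
  qed
  have "adjoint_matrix (X n) = X n" for n
  proof -
    have "D \<in> hermitian_matrices"
      by (simp add: hermitian_matrices_def D_def adjoint_matrix_diag)
    then have "X n \<in> hermitian_matrices"
      unfolding X_def by (intro subspace_scale subspace_diff subspace_hermitian_matrices B(1))
    then show ?thesis
      by (simp add: hermitian_matrices_def)
  qed
  then have "adjoint_matrix H = H"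
    using tendsto_adjoint_matrix [OF X_lim] X_lim LIMSEQ_unique by simp
  then have "H \<in> hermitian_matrices"
    by (simp add: hermitian_matrices_def)
  moreover have "\<forall>a b. d a = d b \<longrightarrow> H $ a $ a = H $ b $ b \<and> (a \<noteq> b \<longrightarrow> H $ a $ b = 0)"
    by (intro allI impI block)
  ultimately show ?thesis
    unfolding block_tangent_def by (intro CollectI conjI)
qed

section \<open>Smooth matrix-valued maps and immersions\<close>

text \<open>Closed under directional derivatives as soon as the generator \<open>G\<close> has a derivative of the
  shape of that of \<open>x \<mapsto> (1 - K x)\<^sup>-\<^sup>1\<close>; this gives smoothness without handling higher
  derivatives.\<close>

inductive matrix_expr :: "('a::euclidean_space \<Rightarrow> complex^'n^'n) \<Rightarrow> ('a \<Rightarrow> complex^'n^'n) \<Rightarrow> bool"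
  for G where
  generator: "matrix_expr G G"
| const: "matrix_expr G (\<lambda>_. C)"
| linear: "linear L \<Longrightarrow> matrix_expr G L"
| comp_linear: "linear L \<Longrightarrow> matrix_expr G F \<Longrightarrow> matrix_expr G (\<lambda>x. L (F x))"
| add: "matrix_expr G F \<Longrightarrow> matrix_expr G F' \<Longrightarrow> matrix_expr G (\<lambda>x. F x + F' x)"
| mult: "matrix_expr G F \<Longrightarrow> matrix_expr G F' \<Longrightarrow> matrix_expr G (\<lambda>x. F x ** F' x)"

text \<open>For each fixed direction the derivative is again an expression in the base point,
  exactly the shape that the recursion in \<open>Ck_on\<close> consumes.\<close>

lemma matrix_expr_has_derivative:
  assumes G: "\<And>x. (G has_derivative (\<lambda>v. G x ** K v ** G x)) (at x)"
    and F: "matrix_expr G F"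
  shows "\<exists>F'. (\<forall>x. (F has_derivative F' x) (at x)) \<and> (\<forall>v. matrix_expr G (\<lambda>x. F' x v))"
  using F
proof induction
  case generator
  show ?case
    by (intro exI [of _ "\<lambda>x v. G x ** K v ** G x"] conjI allI G matrix_expr.mult
        matrix_expr.generator matrix_expr.const)
next
  case (const C)
  show ?case
    by (intro exI [of _ "\<lambda>x v. 0"] conjI allI has_derivative_const matrix_expr.const)
next
  case (linear L)
  then show ?case
    by (intro exI [of _ "\<lambda>x. L"] conjI allI linear_imp_has_derivative matrix_expr.const)
next
  case (comp_linear L F)
  obtain F' where F': "\<And>x. (F has_derivative F' x) (at x)" "\<And>v. matrix_expr G (\<lambda>x. F' x v)"
    using comp_linear(3) by blast
  have "bounded_linear L"
    using comp_linear(1) by (simp add: linear_conv_bounded_linear)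
  from bounded_linear.has_derivative [OF this F'(1)]
    matrix_expr.comp_linear [OF comp_linear(1) F'(2)]
  show ?case
    by (intro exI [of _ "\<lambda>x v. L (F' x v)"] conjI allI)
next
  case (add F1 F2)
  obtain F1' where F1': "\<And>x. (F1 has_derivative F1' x) (at x)"
    "\<And>v. matrix_expr G (\<lambda>x. F1' x v)"
    using add(3) by blast
  obtain F2' where F2': "\<And>x. (F2 has_derivative F2' x) (at x)"
    "\<And>v. matrix_expr G (\<lambda>x. F2' x v)"
    using add(4) by blast
  from has_derivative_add [OF F1'(1) F2'(1)] matrix_expr.add [OF F1'(2) F2'(2)]
  show ?case
    by (intro exI [of _ "\<lambda>x v. F1' x v + F2' x v"] conjI allI)
next
  case (mult F1 F2)
  obtain F1' where F1': "\<And>x. (F1 has_derivative F1' x) (at x)"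
    "\<And>v. matrix_expr G (\<lambda>x. F1' x v)"
    using mult(3) by blast
  obtain F2' where F2': "\<And>x. (F2 has_derivative F2' x) (at x)"
    "\<And>v. matrix_expr G (\<lambda>x. F2' x v)"
    using mult(4) by blast
  from bounded_bilinear.FDERIV [OF bounded_bilinear_matrix_mult F1'(1) F2'(1)]
    matrix_expr.add [OF matrix_expr.mult [OF mult(1) F2'(2)] matrix_expr.mult [OF F1'(2) mult(2)]]
  show ?case
    by (intro exI [of _ "\<lambda>x v. F1 x ** F2' x v + F1' x v ** F2 x"] conjI allI)
qed

lemma matrix_expr_smooth:
  assumes G: "\<And>x. (G has_derivative (\<lambda>v. G x ** K v ** G x)) (at x)"
    and F: "matrix_expr G F"
  shows "smooth_on F U"
proof -
  have "Ck_on k F U" for k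
    using F
  proof (induction k arbitrary: F)
    case 0
    obtain F' where "\<And>x. (F has_derivative F' x) (at x)"
      using matrix_expr_has_derivative [OF G 0] by blast
    then show ?case
      by (auto intro!: continuous_at_imp_continuous_on intro: has_derivative_continuous)
  next
    case (Suc k)
    obtain F' where F': "\<And>x. (F has_derivative F' x) (at x)" "\<And>v. matrix_expr G (\<lambda>x. F' x v)"
      using matrix_expr_has_derivative [OF G Suc(2)] by blast
    have "frechet_derivative F (at x) = F' x" for x
      using frechet_derivative_at [OF F'(1)] by simp
    then show ?case
      using F' Suc(1) by (auto simp: differentiable_def)
  qed
  then show ?thesis
    by (simp add: smooth_on_def)
qed

section \<open>Immersions as local embeddings\<close>

lemma smooth_on_UNIV_imp_derivative:
  assumes "smooth_on f UNIV"
  shows "(f has_derivative frechet_derivative f (at x)) (at x)"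
    and "isCont (\<lambda>x. frechet_derivative f (at x) v) x"
proof -
  have "Ck_on (Suc 0) f UNIV"
    using assms by (simp only: smooth_on_def)
  then show "(f has_derivative frechet_derivative f (at x)) (at x)"
    "isCont (\<lambda>x. frechet_derivative f (at x) v) x"
    by (auto simp: frechet_derivative_works continuous_on_eq_continuous_at)
qed

text \<open>\<open>Ck_on\<close> provides continuity of the derivative one direction at a time.
  Expanding v in the finite basis makes it uniform in v, at the cost of a factor DIM('a).\<close>

lemma continuous_derivative_uniform:
  fixes f' :: "'a::euclidean_space \<Rightarrow> 'a \<Rightarrow> 'b::real_normed_vector"
  assumes lin: "\<And>x. linear (f' x)" and cont: "\<And>v. isCont (\<lambda>x. f' x v) x0" and "0 < e"
  shows "\<forall>\<^sub>F x in nhds x0. \<forall>v. norm (f' x v - f' x0 v) \<le> e * norm v"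
proof -
  define \<epsilon> where "\<epsilon> = e / DIM('a)"
  have "\<epsilon> > 0"
    using assms by (simp add: \<epsilon>_def)
  then have "\<forall>\<^sub>F x in nhds x0. dist (f' x b) (f' x0 b) < \<epsilon>" for b
    using cont [of b] tendsto_at_iff_tendsto_nhds [of "\<lambda>x. f' x b" x0]
    by (intro tendstoD) (simp_all add: isCont_def)
  then have "\<forall>\<^sub>F x in nhds x0. norm (f' x b - f' x0 b) < \<epsilon>" for b
    by (simp add: dist_norm)
  then have "\<forall>\<^sub>F x in nhds x0. \<forall>b\<in>Basis. norm (f' x b - f' x0 b) < \<epsilon>"
    by (simp add: eventually_ball_finite)
  then show ?thesis
  proof (rule eventually_mono, intro allI)
    fix x v
    assume *: "\<forall>b\<in>Basis. norm (f' x b - f' x0 b) < \<epsilon>"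
    have "f' y v = (\<Sum>b\<in>Basis. (v \<bullet> b) *\<^sub>R f' y b)" for y
      using lin [of y] linear_sum [OF lin [of y], of "\<lambda>b. (v \<bullet> b) *\<^sub>R b" Basis]
      by (simp add: euclidean_representation linear_scale)
    then have "f' x v - f' x0 v = (\<Sum>b\<in>Basis. (v \<bullet> b) *\<^sub>R (f' x b - f' x0 b))"
      by (simp add: sum_subtractf scaleR_diff_right)
    also have "norm \<dots> \<le> (\<Sum>b\<in>(Basis :: 'a set). norm v * \<epsilon>)"
    proof (rule order_trans [OF norm_sum sum_mono])
      fix b :: 'a assume "b \<in> Basis"
      then show "norm ((v \<bullet> b) *\<^sub>R (f' x b - f' x0 b)) \<le> norm v * \<epsilon>"
        using * Basis_le_norm [of b v] by (auto intro!: mult_mono intro: less_imp_le)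
    qed
    also have "\<dots> = e * norm v"
      by (simp add: \<epsilon>_def)
    finally show "norm (f' x v - f' x0 v) \<le> e * norm v" .
  qed
qed

text \<open>If the derivative at x0 expands T by the factor c, then on a small ball f differs from
  this linear map by a map with Lipschitz constant c/2. Hence f expands distances on T by c/2, which
  gives injectivity and a Lipschitz inverse at once. The form "for all small r" lets further
  smallness conditions be imposed on the radius.\<close>

lemma immersion_local_embedding:
  fixes f :: "'a::euclidean_space \<Rightarrow> 'b::euclidean_space"
  assumes smooth: "smooth_on f UNIV" and T: "subspace T"
    and inj: "inj_on (frechet_derivative f (at x0)) T"
  shows "\<forall>\<^sub>F r in at_right 0. (\<exists>g. homeomorphism (T \<inter> ball x0 r) (f ` (T \<inter> ball x0 r)) f g) \<and>
    (\<forall>x\<in>T \<inter> ball x0 r. inj_on (frechet_derivative f (at x)) T)"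
proof -
  define f' where "f' x = frechet_derivative f (at x)" for x
  have deriv: "(f has_derivative f' x) (at x)" and cont: "isCont (\<lambda>x. f' x v) y" for x v y
    unfolding f'_def using smooth_on_UNIV_imp_derivative [OF smooth] by auto
  have lin: "linear (f' x)" for x
    using deriv has_derivative_linear by blast
  have inj0: "inj_on (f' x0) T"
    using inj by (simp add: f'_def)
  have "\<forall>v\<in>T. f' x0 v = 0 \<longrightarrow> v = 0"
    using inj0 linear_inj_on_iff_eq_0 [OF lin T] by blast
  then obtain c where c: "c > 0" "\<And>v. v \<in> T \<Longrightarrow> c * norm v \<le> norm (f' x0 v)"
    using injective_imp_isometric [OF closed_subspace [OF T] T, of "f' x0"] lin [of x0]
    by (auto simp: linear_conv_bounded_linear)
  have "\<forall>\<^sub>F x in nhds x0. \<forall>v. norm (f' x v - f' x0 v) \<le> c / 2 * norm v"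
    by (rule continuous_derivative_uniform [OF lin cont]) (use c in simp)
  then obtain R where R: "R > 0"
    "\<And>x v. dist x x0 < R \<Longrightarrow> norm (f' x v - f' x0 v) \<le> c / 2 * norm v"
    unfolding eventually_nhds_metric by blast
  have "(\<exists>g. homeomorphism (T \<inter> ball x0 r) (f ` (T \<inter> ball x0 r)) f g) \<and>
    (\<forall>x\<in>T \<inter> ball x0 r. inj_on (frechet_derivative f (at x)) T)" if r: "r \<le> R" for r
  proof
    let ?S = "T \<inter> ball x0 r"
    have near: "norm (f' x v - f' x0 v) \<le> c / 2 * norm v" if "x \<in> ball x0 r" for x v
      using that r by (intro R(2)) (auto simp: dist_commute)
    have expand: "c / 2 * dist x y \<le> dist (f x) (f y)" if "x \<in> ?S" "y \<in> ?S" for x y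
    proof -
      have "norm ((f x - f' x0 x) - (f y - f' x0 y)) \<le> c / 2 * norm (x - y)"
      proof (rule differentiable_bound [of "ball x0 r" _ "\<lambda>z v. f' z v - f' x0 v"])
        fix z assume z: "z \<in> ball x0 r"
        show "((\<lambda>x. f x - f' x0 x) has_derivative (\<lambda>v. f' z v - f' x0 v)) (at z within ball x0 r)"
          by (intro has_derivative_diff has_derivative_at_withinI [OF deriv]
              linear_imp_has_derivative lin)
        show "onorm (\<lambda>v. f' z v - f' x0 v) \<le> c / 2"
          by (rule onorm_le) (rule near [OF z])
      qed (use that in auto)
      moreover have "c * norm (x - y) \<le> norm (f' x0 (x - y))"
        using that T by (intro c subspace_diff) auto
      moreover have "f x - f y = ((f x - f' x0 x) - (f y - f' x0 y)) + f' x0 (x - y)"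
        by (simp add: linear_diff [OF lin])
      then have "norm (f' x0 (x - y)) \<le>
          norm (f x - f y) + norm ((f x - f' x0 x) - (f y - f' x0 y))"
        by (metis add_diff_cancel_left' norm_triangle_ineq4)
      ultimately show ?thesis
        by (simp add: dist_norm field_simps)
    qed
    have "inj_on f ?S"
    proof (rule inj_onI)
      fix x y assume "x \<in> ?S" "y \<in> ?S" "f x = f y"
      with expand [of x y] have "c / 2 * dist x y \<le> 0"
        by simp
      with c(1) show "x = y"
        by (simp add: mult_le_0_iff)
    qed
    then have g: "inv_into ?S f (f x) = x" if "x \<in> ?S" for x
      using that by (rule inv_into_f_f)
    have "(2 / c)-lipschitz_on (f ` ?S) (inv_into ?S f)"
    proof (rule lipschitz_onI)
      fix u v assume "u \<in> f ` ?S" "v \<in> f ` ?S"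
      then obtain x y where xy: "x \<in> ?S" "y \<in> ?S" "u = f x" "v = f y"
        by blast
      show "dist (inv_into ?S f u) (inv_into ?S f v) \<le> 2 / c * dist u v"
        using expand [OF xy(1,2)] c(1) unfolding xy(3,4) g [OF xy(1)] g [OF xy(2)]
        by (simp add: field_simps)
    qed (use c in simp)
    then have "continuous_on (f ` ?S) (inv_into ?S f)"
      by (rule lipschitz_on_continuous_on)
    moreover have "continuous_on ?S f"
      using deriv by (intro continuous_at_imp_continuous_on ballI has_derivative_continuous)
    ultimately have "homeomorphism ?S (f ` ?S) f (inv_into ?S f)"
      using g by (intro homeomorphismI) auto
    then show "\<exists>g. homeomorphism ?S (f ` ?S) f g"
      by blast
    show "\<forall>x\<in>?S. inj_on (frechet_derivative f (at x)) T"
    proof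
      fix x assume x: "x \<in> ?S"
      have "v = 0" if v: "v \<in> T" "f' x v = 0" for v
      proof -
        have "c * norm v \<le> norm (f' x0 v)"
          using v by (intro c)
        moreover have "norm (f' x0 v) \<le> c / 2 * norm v"
          using near [of x v] x v by simp
        ultimately have "c / 2 * norm v \<le> 0"
          by simp
        with c(1) show ?thesis
          by (simp add: mult_le_0_iff)
      qed
      then show "inj_on (frechet_derivative f (at x)) T"
        using linear_inj_on_iff_eq_0 [OF lin T] unfolding f'_def by blast
    qed
  qed
  then show ?thesis
    unfolding eventually_at_right_field using R(1) less_imp_le by blast
qed

section \<open>The upper bound\<close>

lemma hermitian_with_multiplicities_card_eigenvalues:
  assumes "A \<in> hermitian_with_multiplicities I k"
  shows "card (eigenvalues A) = I"
proof -
  obtain c where "bij_betw c {1..I} (eigenvalues A)"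
    using assms unfolding hermitian_with_multiplicities_def by blast
  then show ?thesis
    using bij_betw_same_card by fastforce
qed

lemma has_derivative_imp_directional_LIMSEQ:
  fixes f :: "'a::real_normed_vector \<Rightarrow> 'b::real_normed_vector"
  assumes f: "(f has_derivative f') (at x)" and t: "t \<longlonglongrightarrow> 0" "\<And>n. t n \<noteq> (0 :: real)"
  shows "(\<lambda>n. (f (x + t n *\<^sub>R v) - f x) /\<^sub>R t n) \<longlonglongrightarrow> f' v"
proof -
  interpret f': bounded_linear f'
    using f by (rule has_derivative_bounded_linear)
  have "((\<lambda>h. f (x + h *\<^sub>R v)) has_derivative (\<lambda>h. f' (h *\<^sub>R v))) (at 0)"
    by (rule has_derivative_compose [of "\<lambda>h. x + h *\<^sub>R v" "\<lambda>h. h *\<^sub>R v" 0 UNIV f f', simplified])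
      (auto intro!: derivative_eq_intros f)
  then have "(\<lambda>h. norm (f (x + h *\<^sub>R v) - f x - h *\<^sub>R f' v) / norm h) \<midarrow>0\<rightarrow> 0"
    by (simp add: has_derivative_at f'.scaleR)
  moreover have "filterlim t (at 0) sequentially"
    using t by (auto simp: filterlim_at)
  ultimately have "(\<lambda>n. norm (f (x + t n *\<^sub>R v) - f x - t n *\<^sub>R f' v) / norm (t n)) \<longlonglongrightarrow> 0"
    by (rule filterlim_compose)
  also have "(\<lambda>n. norm (f (x + t n *\<^sub>R v) - f x - t n *\<^sub>R f' v) / norm (t n)) =
      (\<lambda>n. norm ((f (x + t n *\<^sub>R v) - f x) /\<^sub>R t n - f' v))"
  proof
    fix n
    have "(f (x + t n *\<^sub>R v) - f x) /\<^sub>R t n - f' v =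
        (f (x + t n *\<^sub>R v) - f x - t n *\<^sub>R f' v) /\<^sub>R t n"
      using t(2) [of n] by (simp add: scaleR_diff_right)
    then show "norm (f (x + t n *\<^sub>R v) - f x - t n *\<^sub>R f' v) / norm (t n) =
        norm ((f (x + t n *\<^sub>R v) - f x) /\<^sub>R t n - f' v)"
      by (simp add: divide_inverse mult.commute)
  qed
  finally show ?thesis
    using LIM_zero_cancel tendsto_norm_zero_iff by blast
qed

text \<open>At one point of a chart the derivative is injective on T, and each of its values is a
  limit of difference quotients along a segment in T \<inter> U. After conjugation they all lie in
  \<open>block_tangent d\<close>, whose dimension formula is stated without subtraction.\<close>

lemma dim_submanifold_le:
  fixes M :: "(complex^'n^'n) set"
  assumes M: "smooth_submanifold m M" "M \<noteq> {}" "M \<subseteq> hermitian_with_multiplicities I k"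
  shows "m + (\<Sum>i=1..I. (k i)\<^sup>2) \<le> CARD('n)\<^sup>2 + I"
proof -
  obtain p where "p \<in> M"
    using M(2) by blast
  then obtain V and T :: "(complex^'n^'n) set" and U f g where
    V: "p \<in> V" and T: "subspace T" "dim T = m" and U: "open U" "smooth_on f U"
    and homeo: "homeomorphism (T \<inter> U) (M \<inter> V) f g"
    and inj: "\<forall>x\<in>T \<inter> U. inj_on (frechet_derivative f (at x)) T"
    using M(1) unfolding smooth_submanifold_def by metis
  define x0 where "x0 = g p"
  have "p \<in> M \<inter> V"
    using V \<open>p \<in> M\<close> by blast
  then have x0: "x0 \<in> T" "x0 \<in> U" "f x0 = p"
    using homeo unfolding homeomorphism_def x0_def by auto
  have f_mem: "f x \<in> hermitian_with_multiplicities I k" if "x \<in> T" "x \<in> U" for x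
    using homeo that M(3) unfolding homeomorphism_def by blast
  have herm: "A \<in> hermitian_matrices"
    if "A \<in> hermitian_with_multiplicities I k" for A :: "complex^'n^'n"
    using that by (simp add: hermitian_with_multiplicities_def)
  obtain Q d where Q: "unitary_matrix Q"
    and p: "p = Q ** diag_matrix (\<lambda>a. complex_of_real (d a)) ** adjoint_matrix Q"
    using hermitian_unitary_diagonalization [OF herm [OF f_mem [OF x0(1,2)]]] x0(3) by blast
  have "p \<in> hermitian_with_multiplicities I k"
    using \<open>p \<in> M\<close> M(3) by blast
  then obtain c where c: "bij_betw c {1..I} (range (\<lambda>a. complex_of_real (d a)))"
    "\<forall>i\<in>{1..I}. card {a. complex_of_real (d a) = c i} = k i"
    unfolding p unitary_diag_in_hermitian_with_multiplicities_iff [OF Q] by blast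
  have "card (range d) = card (range (\<lambda>a. complex_of_real (d a)))"
    by (metis card_image image_image inj_of_real inj_on_subset subset_UNIV)
  then have card_d: "card (range d) = I"
    using bij_betw_same_card [OF c(1)] by simp
  define f' where "f' = frechet_derivative f (at x0)"
  have "Ck_on (Suc 0) f U"
    using U(2) by (simp only: smooth_on_def)
  then have f': "(f has_derivative f') (at x0)"
    using x0(2) by (simp add: f'_def frechet_derivative_works)
  \<comment> \<open>Undoes the diagonalization: \<open>L p\<close> is the diagonal matrix of d, the
    base point required by \<open>derivative_in_block_tangent\<close>.\<close>
  define L where "L A = adjoint_matrix Q ** A ** Q" for A
  have lin_L: "linear L"
    unfolding L_def
    using bounded_linear_compose [OF bounded_bilinear.bounded_linear_left
        [OF bounded_bilinear_matrix_mult, of Q] bounded_bilinear.bounded_linear_right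
        [OF bounded_bilinear_matrix_mult, of "adjoint_matrix Q"]]
    by (simp add: linear_conv_bounded_linear)
  have L_inv: "Q ** L A ** adjoint_matrix Q = A" for A
    unfolding L_def using unitary_matrix_right [OF Q]
    by (metis matrix_mul_assoc matrix_mul_lid matrix_mul_rid)
  have lin_Lf': "linear (\<lambda>v. L (f' v))"
    using linear_compose [OF has_derivative_linear [OF f'] lin_L] by (simp add: o_def)
  have "inj_on (\<lambda>v. L (f' v)) T"
  proof (rule inj_onI)
    fix v w assume "v \<in> T" "w \<in> T" "L (f' v) = L (f' w)"
    moreover from this have "f' v = f' w"
      using L_inv by metis
    ultimately show "v = w"
      using inj x0 unfolding f'_def inj_on_def by blast
  qed
  moreover have "L (f' v) \<in> block_tangent d" if v: "v \<in> T" for v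
  proof -
    obtain e where e: "e > 0" "ball x0 e \<subseteq> U"
      using U(1) x0(2) open_contains_ball by blast
    \<comment> \<open>The summand 1 in the denominator covers v = 0; all times t n \<le> s keep the
      segment inside the ball.\<close>
    define s where "s = e / (norm v + 1)"
    have s: "s > 0" "s * norm v < e"
      using e(1) by (auto simp: s_def field_simps add_pos_nonneg)
    define t where "t n = s / real (Suc n)" for n
    have t: "t \<longlonglongrightarrow> 0" "t n > 0" for n
      unfolding t_def using s(1) LIMSEQ_Suc [OF lim_const_over_n [of s]] by auto
    have t_ne: "t n \<noteq> 0" for n
      using t(2) [of n] by simp
    have t_le: "t n \<le> s" for n
      using s(1) by (simp add: t_def field_simps)
    have mem: "f (x0 + t n *\<^sub>R v) \<in> hermitian_with_multiplicities I k" for n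
    proof (rule f_mem)
      show "x0 + t n *\<^sub>R v \<in> T"
        using T(1) v x0(1) by (intro subspace_add subspace_scale)
      have "t n * norm v \<le> s * norm v"
        by (intro mult_right_mono t_le) simp
      then have "x0 + t n *\<^sub>R v \<in> ball x0 e"
        using s(2) t(2) [of n] by (simp add: dist_norm)
      then show "x0 + t n *\<^sub>R v \<in> U"
        using e(2) by blast
    qed
    have quot: "(\<lambda>n. (f (x0 + t n *\<^sub>R v) - f x0) /\<^sub>R t n) \<longlonglongrightarrow> f' v"
      by (rule has_derivative_imp_directional_LIMSEQ [OF f' t(1) t_ne])
    have Lp: "L p = diag_matrix (\<lambda>a. complex_of_real (d a))"
      unfolding L_def p using unitary_matrix_left [OF Q]
      by (metis matrix_mul_assoc matrix_mul_lid matrix_mul_rid)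
    show ?thesis
    proof (rule derivative_in_block_tangent [where B = "\<lambda>n. L (f (x0 + t n *\<^sub>R v))" and t = t])
      fix n
      have "adjoint_matrix (f (x0 + t n *\<^sub>R v)) = f (x0 + t n *\<^sub>R v)"
        using herm [OF mem] by (simp add: hermitian_matrices_def)
      then show "L (f (x0 + t n *\<^sub>R v)) \<in> hermitian_matrices"
        by (simp add: hermitian_matrices_def L_def adjoint_matrix_mult matrix_mul_assoc)
      show "card (eigenvalues (L (f (x0 + t n *\<^sub>R v)))) = card (range d)"
        unfolding L_def eigenvalues_similar [OF unitary_matrix_left [OF Q]]
        using hermitian_with_multiplicities_card_eigenvalues [OF mem] card_d by simp
      show "t n \<noteq> 0"
        by (rule t_ne)
    next
      have "bounded_linear L"
        using lin_L by (simp add: linear_conv_bounded_linear)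
      from bounded_linear.tendsto [OF this quot]
      show "(\<lambda>n. (L (f (x0 + t n *\<^sub>R v)) - diag_matrix (\<lambda>a. complex_of_real (d a))) /\<^sub>R t n)
          \<longlonglongrightarrow> L (f' v)"
        by (simp add: linear_scale [OF lin_L] linear_diff [OF lin_L] x0(3) Lp)
    qed (rule t)
  qed
  ultimately have "dim T \<le> dim (block_tangent d)"
    using dim_image_eq [OF lin_Lf', of T] T(1)
    by (metis (no_types, lifting) dim_subset image_subsetI span_eq_iff)
  moreover have "card {(a, b). d a = d b} = (\<Sum>i=1..I. (k i)\<^sup>2)"
    using card_pairs_same_fibre [OF c(1)] c(2) by simp
  ultimately show ?thesis
    using dim_block_tangent [of d] card_d T(2) by simp
qed

section \<open>Cayley transforms\<close>

lemma skew_inner_zero: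
  fixes K :: "complex^'n^'n"
  assumes "adjoint_matrix K = - K"
  shows "(K *v w) \<bullet> w = 0"
proof -
  have "(- K) *v w = - (K *v w)"
    by (simp add: matrix_vector_mult_def vec_eq_iff sum_negf)
  then have "(K *v w) \<bullet> w = - (w \<bullet> (K *v w))"
    using inner_adjoint_matrix [of K w w] assms by simp
  then show ?thesis
    by (simp add: inner_commute)
qed

text \<open>K w is orthogonal to w for the real inner product, so pairing (1 - K) w with w leaves
  the squared norm of w. The estimate holds for skew-hermitian K of any size, which makes the Cayley
  transform globally defined.\<close>

lemma norm_le_one_minus_skew:
  fixes K :: "complex^'n^'n"
  assumes "adjoint_matrix K = - K"
  shows "norm w \<le> norm ((mat 1 - K) *v w)"
proof -
  have "w \<bullet> w = ((mat 1 - K) *v w) \<bullet> w"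
    by (simp add: matrix_vector_mult_diff_rdistrib inner_diff_left skew_inner_zero [OF assms])
  also have "\<dots> \<le> norm ((mat 1 - K) *v w) * norm w"
    by (rule norm_cauchy_schwarz)
  finally have "norm w * norm w \<le> norm ((mat 1 - K) *v w) * norm w"
    by (simp add: dot_square_norm power2_eq_square)
  then show ?thesis
    by (cases "w = 0") auto
qed

text \<open>A square matrix with trivial kernel is invertible, and the preceding estimate makes the
  inverse norm-nonincreasing, so its columns have norm at most 1. The point of the crude bound is
  its independence of K.\<close>

lemma one_minus_skew_inverse:
  fixes K :: "complex^'n^'n"
  assumes "adjoint_matrix K = - K"
  shows "(mat 1 - K) ** matrix_inv (mat 1 - K) = mat 1"
    and "matrix_inv (mat 1 - K) ** (mat 1 - K) = mat 1"
    and "norm (matrix_inv (mat 1 - K)) \<le> real CARD('n) * real CARD('n)"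
proof -
  have "w = 0" if "(mat 1 - K) *v w = 0" for w
    using norm_le_one_minus_skew [OF assms, of w] that by simp
  then have "\<exists>B. B ** (mat 1 - K) = mat 1"
    unfolding matrix_left_invertible_ker by blast
  then have "\<exists>B. (mat 1 - K) ** B = mat 1 \<and> B ** (mat 1 - K) = mat 1"
    using matrix_left_right_inverse by blast
  from someI_ex [OF this]
  show right: "(mat 1 - K) ** matrix_inv (mat 1 - K) = mat 1"
    and "matrix_inv (mat 1 - K) ** (mat 1 - K) = mat 1"
    unfolding matrix_inv_def by blast+
  show "norm (matrix_inv (mat 1 - K)) \<le> real CARD('n) * real CARD('n)"
  proof (rule norm_matrix_le_of_entries)
    fix i j
    have "norm (matrix_inv (mat 1 - K) $ i $ j) = norm ((matrix_inv (mat 1 - K) *v axis j 1) $ i)"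
      by (simp add: matrix_vector_mult_def axis_def if_distrib [of "(*) _"] cong: if_cong)
    also have "\<dots> \<le> norm (matrix_inv (mat 1 - K) *v axis j 1)"
      unfolding norm_vec_def [of "_ *v _"] by (rule member_le_L2_set) auto
    also have "\<dots> \<le> norm ((mat 1 - K) *v (matrix_inv (mat 1 - K) *v axis j 1))"
      by (rule norm_le_one_minus_skew [OF assms])
    also have "\<dots> = norm (axis j 1 :: complex^'n)"
      by (simp add: matrix_vector_mul_assoc right)
    also have "\<dots> = 1"
      by (simp add: norm_eq_1 inner_axis_axis)
    finally show "norm (matrix_inv (mat 1 - K) $ i $ j) \<le> 1" .
  qed
qed

text \<open>Everything follows from the resolvent identity G y - G x = G y K(y - x) G x: with the
  uniform bound on G it first gives continuity, then the derivative.\<close>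

lemma matrix_inv_one_minus_skew_has_derivative:
  fixes K :: "'a::euclidean_space \<Rightarrow> complex^'n^'n"
  assumes lin: "linear K" and skew: "\<And>v. adjoint_matrix (K v) = - K v"
  defines "G \<equiv> \<lambda>v. matrix_inv (mat 1 - K v)"
  shows "(G has_derivative (\<lambda>v. G x ** K v ** G x)) (at x)"
proof -
  interpret mult: bounded_bilinear "(**) :: complex^'n^'n \<Rightarrow> complex^'n^'n \<Rightarrow> complex^'n^'n"
    by (rule bounded_bilinear_matrix_mult)
  have G: "(mat 1 - K v) ** G v = mat 1" "G v ** (mat 1 - K v) = mat 1"
    "norm (G v) \<le> real CARD('n) * real CARD('n)" for v
    unfolding G_def using one_minus_skew_inverse [OF skew] by auto
  have diff: "G y - G x = G y ** K (y - x) ** G x" for x y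
  proof -
    have "K (y - x) = (mat 1 - K x) - (mat 1 - K y)"
      by (simp add: linear_diff [OF lin])
    then have "G y ** K (y - x) ** G x =
        G y ** ((mat 1 - K x) ** G x) - (G y ** (mat 1 - K y)) ** G x"
      by (simp only: matrix_mult_diff_left matrix_mult_diff_right matrix_mul_assoc)
    then show ?thesis
      by (simp add: G)
  qed
  have lin': "bounded_linear K"
    using lin by (simp add: linear_conv_bounded_linear)
  obtain C where C: "C > 0" "\<And>(A :: complex^'n^'n) (B :: complex^'n^'n). norm (A ** B) \<le> norm A * norm B * C"
    using mult.pos_bounded by metis
  obtain \<kappa> where \<kappa>: "\<kappa> > 0" "\<And>v. norm (K v) \<le> norm v * \<kappa>"
    using bounded_linear.pos_bounded [OF lin'] by metis
  define N where "N = real CARD('n) * real CARD('n)"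
  have N: "norm (G v) \<le> N" "N \<ge> 0" for v
    using G(3) by (simp_all add: N_def)
  define R where "R v = norm v * (N * \<kappa> * C * N * C)" for v :: 'a
  have GKG: "norm (G y ** K v ** G x) \<le> R v" for x y v
  proof -
    have "norm (G y ** K v) \<le> N * (norm v * \<kappa>) * C"
      using C N \<kappa> by (intro order_trans [OF C(2)] mult_mono) auto
    then have "norm (G y ** K v ** G x) \<le> (N * (norm v * \<kappa>) * C) * N * C"
      using C N \<kappa> by (intro order_trans [OF C(2)] mult_mono) auto
    then show ?thesis
      by (simp add: R_def mult_ac)
  qed
  have G_cont: "isCont G x"
  proof -
    have "((\<lambda>y. R (y - x)) \<longlongrightarrow> R (x - x)) (at x)"
      unfolding R_def by (intro tendsto_intros)
    then have "((\<lambda>y. R (y - x)) \<longlongrightarrow> 0) (at x)"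
      by (simp add: R_def)
    then have "((\<lambda>y. G y - G x) \<longlongrightarrow> 0) (at x)"
      by (rule Lim_null_comparison [rotated]) (simp add: diff GKG)
    then show ?thesis
      by (simp add: isCont_def LIM_zero_iff)
  qed
  have K0: "K (x - x) = 0"
    by (simp add: linear_0 [OF lin])
  show ?thesis
  proof (rule has_derivativeI_sandwich [where e = 1 and
        H = "\<lambda>y. norm (G y - G x) * \<kappa> * C * N * C"])
    show "bounded_linear (\<lambda>v. G x ** K v ** G x)"
      using bounded_linear_compose [OF bounded_linear_compose [OF mult.bounded_linear_left [of "G x"]
          mult.bounded_linear_right [of "G x"]] lin'] by (simp add: o_def)
    have "((\<lambda>y. norm (G y - G x) * \<kappa> * C * N * C) \<longlongrightarrow> norm (G x - G x) * \<kappa> * C * N * C) (at x)"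
      using G_cont unfolding isCont_def by (intro tendsto_intros)
    then show "((\<lambda>y. norm (G y - G x) * \<kappa> * C * N * C) \<longlongrightarrow> 0) (at x)"
      by simp
    fix y assume "y \<noteq> x"
    \<comment> \<open>By the resolvent identity, the remainder is linear in y - x times G y - G x,
      which tends to 0 by continuity.\<close>
    have "G y - G x - G x ** K (y - x) ** G x = (G y - G x) ** K (y - x) ** G x"
      by (simp add: diff [of y x] matrix_mult_diff_left) (simp add: diff flip: matrix_mult_diff_left)
    also have "norm \<dots> \<le> norm ((G y - G x) ** K (y - x)) * norm (G x) * C"
      by (rule C)
    also have "\<dots> \<le> (norm (G y - G x) * (norm (y - x) * \<kappa>) * C) * N * C"
      using C N \<kappa> by (intro mult_mono order_trans [OF C(2)]) auto
    finally show "norm (G y - G x - G x ** K (y - x) ** G x) / norm (y - x) \<le>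
        norm (G y - G x) * \<kappa> * C * N * C"
      using \<open>y \<noteq> x\<close> by (simp add: divide_le_eq mult_ac)
  qed simp
qed

text \<open>Taking adjoints turns (1 - K) G = 1 into G* (1 + K) = 1, and 1 + K commutes with 1 - K,
  so the four factors cancel in pairs.\<close>

lemma cayley_unitary:
  fixes K :: "complex^'n^'n"
  assumes skew: "adjoint_matrix K = - K"
  shows "unitary_matrix ((mat 1 + K) ** matrix_inv (mat 1 - K))"
proof -
  define G where "G = matrix_inv (mat 1 - K)"
  have G: "(mat 1 - K) ** G = mat 1"
    unfolding G_def by (rule one_minus_skew_inverse [OF skew])
  have "adjoint_matrix G ** (mat 1 + K) = adjoint_matrix ((mat 1 - K) ** G)"
    by (simp add: adjoint_matrix_mult adjoint_matrix_diff skew)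
  then have G': "adjoint_matrix G ** (mat 1 + K) = mat 1"
    by (simp add: G)
  have "adjoint_matrix ((mat 1 + K) ** G) ** ((mat 1 + K) ** G) =
      adjoint_matrix G ** ((mat 1 - K) ** (mat 1 + K)) ** G"
    by (simp add: adjoint_matrix_mult adjoint_matrix_add skew matrix_mul_assoc)
  also have "(mat 1 - K) ** (mat 1 + K) = (mat 1 + K) ** (mat 1 - K)"
    by (simp add: matrix_mult_diff_left matrix_mult_diff_right matrix_add_ldistrib
        matrix_add_rdistrib)
  also have "adjoint_matrix G ** ((mat 1 + K) ** (mat 1 - K)) ** G =
      (adjoint_matrix G ** (mat 1 + K)) ** ((mat 1 - K) ** G)"
    by (simp only: matrix_mul_assoc)
  finally show ?thesis
    by (simp add: unitary_matrix_def G G' flip: G_def)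
qed

section \<open>Block labels and enumerations of eigenvalues\<close>

lemma block_labels_exist:
  fixes k :: "nat \<Rightarrow> nat"
  assumes "(\<Sum>i=1..I. k i) = CARD('n::finite)"
  obtains \<beta> :: "'n::finite \<Rightarrow> nat" where "range \<beta> \<subseteq> {1..I}" "\<And>i. i \<in> {1..I} \<Longrightarrow> card {a. \<beta> a = i} = k i"
proof -
  \<comment> \<open>A disjoint union of blocks of sizes k i has n elements; a bijection from the
    index type carries its block number over.\<close>
  define S where "S = (SIGMA i:{1..I}. {..<k i})"
  have "card S = CARD('n)"
    using assms by (simp add: S_def)
  moreover have "finite S"
    by (simp add: S_def)
  ultimately obtain h :: "'n \<Rightarrow> nat \<times> nat" where h: "bij_betw h UNIV S"
    using finite_same_card_bij [of "UNIV :: 'n set" S] by auto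
  have hS: "h a \<in> S" for a
    using bij_betw_imp_surj_on [OF h] by blast
  have "fst (h a) \<in> {1..I}" for a
    using hS [of a] by (cases "h a") (simp add: S_def)
  then have "range (fst \<circ> h) \<subseteq> {1..I}"
    by (simp add: image_subset_iff)
  moreover have "card {a. (fst \<circ> h) a = i} = k i" if "i \<in> {1..I}" for i
  proof -
    have "h ` {a. (fst \<circ> h) a = i} = {i} \<times> {..<k i}"
    proof (intro equalityI subsetI)
      fix p assume "p \<in> {i} \<times> {..<k i}"
      then have "p \<in> S" "fst p = i"
        using that by (auto simp: S_def)
      then obtain a where "p = h a"
        using bij_betw_imp_surj_on [OF h] by blast
      with \<open>fst p = i\<close> show "p \<in> h ` {a. (fst \<circ> h) a = i}"
        by auto
    next
      fix p assume "p \<in> h ` {a. (fst \<circ> h) a = i}"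
      then have "p \<in> S" "fst p = i"
        using bij_betw_imp_surj_on [OF h] by auto
      then show "p \<in> {i} \<times> {..<k i}"
        by (auto simp: S_def)
    qed
    moreover have "inj_on h {a. (fst \<circ> h) a = i}"
      using bij_betw_imp_inj_on [OF h] inj_on_subset by blast
    ultimately have "card {a. (fst \<circ> h) a = i} = card ({i} \<times> {..<k i})"
      by (metis card_image)
    then show ?thesis
      by simp
  qed
  ultimately show ?thesis
    using that by blast
qed

text \<open>Turns the enumeration of labels into one of eigenvalues when both have the same fibres,
  as happens along the constructed family.\<close>

lemma refine_enumeration:
  assumes "\<And>a b. \<delta> a = \<delta> b \<longleftrightarrow> \<beta> a = \<beta> b"
  obtains c where "bij_betw c (range \<beta>) (range \<delta>)"
    "\<And>i. i \<in> range \<beta> \<Longrightarrow> {a. \<delta> a = c i} = {a. \<beta> a = i}"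
proof -
  define c where "c i = \<delta> (SOME a. \<beta> a = i)" for i
  have c\<beta>: "c (\<beta> a) = \<delta> a" for a
    unfolding c_def assms by (rule someI) (rule refl)
  have "bij_betw c (range \<beta>) (range \<delta>)"
    by (rule bij_betw_imageI) (auto simp: inj_on_def c\<beta> assms image_image)
  moreover have "{a. \<delta> a = c i} = {a. \<beta> a = i}" if "i \<in> range \<beta>" for i
    using that by (auto simp: c\<beta> assms)
  ultimately show ?thesis
    using that by blast
qed

section \<open>The lower bound\<close>

lemma submanifold_exists:
  fixes \<beta> :: "'n::finite \<Rightarrow> nat"
  assumes range_\<beta>: "range \<beta> = {1..I}" and card_\<beta>: "\<And>i. i \<in> {1..I} \<Longrightarrow> card {a. \<beta> a = i} = k i"
  obtains M :: "(complex^'n^'n) set" where "M \<noteq> {}" "M \<subseteq> hermitian_with_multiplicities I k"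
    "smooth_submanifold (dim (block_tangent \<beta>)) M"
proof -
  define T :: "(complex^'n^'n) set" where "T = block_tangent \<beta>"
  \<comment> \<open>The label itself serves as the eigenvalue of its block, so different eigenvalues
    are at least 1 apart.\<close>
  define b where "b a = complex_of_real (real (\<beta> a))" for a
  \<comment> \<open>Division by zero makes the entries of \<open>K v\<close> inside the blocks vanish.\<close>
  define K :: "complex^'n^'n \<Rightarrow> complex^'n^'n" where
    "K v = (\<chi> i j. (v $ i $ j + cnj (v $ j $ i)) / (4 * (b j - b i)))" for v
  define \<Delta> :: "complex^'n^'n \<Rightarrow> complex^'n^'n" where
    "\<Delta> v = diag_matrix (\<lambda>i. complex_of_real (Re (v $ i $ i)))" for v
  define G where "G v = matrix_inv (mat 1 - K v)" for v
  define Q where "Q v = (mat 1 + K v) ** G v" for v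
  define D where "D v = diag_matrix b + \<Delta> v" for v
  define f where "f v = Q v ** D v ** adjoint_matrix (Q v)" for v
  have lin_K: "linear K"
  proof (rule linearI)
    show "K (v + w) = K v + K w" for v w
      by (simp add: K_def vec_eq_iff add_divide_distrib)
    show "K (c *\<^sub>R v) = c *\<^sub>R K v" for c v
      unfolding K_def vec_eq_iff vector_scaleR_component vec_lambda_beta
      by (simp add: scaleR_conv_of_real distrib_left)
  qed
  have lin_\<Delta>: "linear \<Delta>"
  proof (rule linearI)
    show "\<Delta> (v + w) = \<Delta> v + \<Delta> w" for v w
      by (simp add: \<Delta>_def diag_matrix_def vec_eq_iff)
    show "\<Delta> (c *\<^sub>R v) = c *\<^sub>R \<Delta> v" for c v
      unfolding \<Delta>_def diag_matrix_def vec_eq_iff vector_scaleR_component vec_lambda_beta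
      by (simp add: scaleR_conv_of_real)
  qed
  \<comment> \<open>The numerator is hermitian in (i, j) for every v and the real denominator is
    antisymmetric. Skewness on the whole space, not only on T, is what lets f be smooth on an open
    ambient set.\<close>
  have skew: "adjoint_matrix (K v) = - K v" for v
  proof -
    have cnj_b: "cnj (b i) = b i" for i
      by (simp add: b_def)
    have "cnj (K v $ j $ i) = - K v $ i $ j" for i j
    proof -
      have "4 * (b i - b j) = - (4 * (b j - b i))"
        by simp
      then have "cnj (K v $ j $ i) = (cnj (v $ j $ i) + v $ i $ j) / - (4 * (b j - b i))"
        by (simp only: K_def vec_lambda_beta complex_cnj_divide complex_cnj_add complex_cnj_cnj
            complex_cnj_mult complex_cnj_diff complex_cnj_minus cnj_b complex_cnj_numeral)
      also have "\<dots> = - K v $ i $ j"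
        unfolding divide_minus_right K_def vec_lambda_beta by (simp only: add.commute)
      finally show ?thesis .
    qed
    then show ?thesis
      unfolding adjoint_matrix_def vec_eq_iff by simp
  qed
  have K_0: "K 0 = 0" and \<Delta>_0: "\<Delta> 0 = 0"
    using linear_0 [OF lin_K] linear_0 [OF lin_\<Delta>] by auto
  have G_deriv: "(G has_derivative (\<lambda>v. G x ** K v ** G x)) (at x)" for x
    unfolding G_def by (rule matrix_inv_one_minus_skew_has_derivative [OF lin_K skew])
  have G_0: "G 0 = mat 1"
    using one_minus_skew_inverse(1) [OF skew, of 0] by (simp add: G_def K_0)
  have Q_0: "Q 0 = mat 1"
    by (simp add: Q_def K_0 G_0)
  have Q_unitary: "unitary_matrix (Q v)" for v
    unfolding Q_def G_def by (rule cayley_unitary [OF skew])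
  have expr_Q: "matrix_expr G Q"
    unfolding Q_def
    by (rule matrix_expr.mult [OF matrix_expr.add [OF matrix_expr.const matrix_expr.linear [OF lin_K]]
          matrix_expr.generator])
  have expr_D: "matrix_expr G D"
    unfolding D_def by (rule matrix_expr.add [OF matrix_expr.const matrix_expr.linear [OF lin_\<Delta>]])
  have "matrix_expr G f"
    unfolding f_def
    by (rule matrix_expr.mult [OF matrix_expr.mult [OF expr_Q expr_D]
          matrix_expr.comp_linear [OF linear_adjoint_matrix expr_Q]])
  then have smooth: "smooth_on f U" for U
    using G_deriv by (intro matrix_expr_smooth)
  note mult_deriv = bounded_bilinear.FDERIV [OF bounded_bilinear_matrix_mult]
  have K_deriv: "((\<lambda>v. mat 1 + K v) has_derivative K) (at 0)"
    using has_derivative_add [OF has_derivative_const linear_imp_has_derivative [OF lin_K]] by simp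
  have D_deriv: "(D has_derivative \<Delta>) (at 0)"
    unfolding D_def
    using has_derivative_add [OF has_derivative_const linear_imp_has_derivative [OF lin_\<Delta>]] by simp
  have Q_deriv: "(Q has_derivative (\<lambda>v. K v + K v)) (at 0)"
    unfolding Q_def using mult_deriv [OF K_deriv G_deriv] by (simp add: K_0 G_0)
  have "adjoint_matrix (K v + K v) = - (K v + K v)" for v
    by (simp only: adjoint_matrix_add skew minus_add_distrib)
  then have adj_Q_deriv: "((\<lambda>v. adjoint_matrix (Q v)) has_derivative (\<lambda>v. - (K v + K v))) (at 0)"
    using bounded_linear.has_derivative [OF linear_adjoint_matrix [unfolded
          linear_conv_bounded_linear] Q_deriv] by (simp only:)
  \<comment> \<open>Product rule at 0, where Q = 1, Q' = 2K, and its adjoint has derivative -2K: the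
    result is \<Delta> v plus the commutator of 2 K v with D 0.\<close>
  define f' where "f' v = D 0 ** - (K v + K v) + (\<Delta> v + (K v + K v) ** D 0)" for v
  have f_deriv: "(f has_derivative f') (at 0)"
    unfolding f_def f'_def
    using mult_deriv [OF mult_deriv [OF Q_deriv D_deriv] adj_Q_deriv] by (simp add: Q_0)
  have f'_T: "f' v = v" if v: "v \<in> T" for v
  proof -
    have D_0: "D 0 = diag_matrix b"
      by (simp add: D_def \<Delta>_0)
    have "v $ i $ j = cnj (v $ j $ i)" for i j
      using v unfolding T_def block_tangent_def hermitian_matrices_iff by blast
    then have herm: "cnj (v $ j $ i) = v $ i $ j" for i j
      by (rule sym)
    have "f' v $ i $ j = v $ i $ j" for i j
    proof -
      \<comment> \<open>The origin of the 4: the commutator contributes 2 (b j - b i), and on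
        hermitian v the numerator of K is 2 \<open>v $ i $ j\<close>. With this normalization f' is
        the identity on T.\<close>
      have "f' v $ i $ j = \<Delta> v $ i $ j + 2 * K v $ i $ j * (b j - b i)"
        unfolding f'_def D_0 vector_add_component diag_matrix_mult_left diag_matrix_mult_right
        by (simp add: algebra_simps)
      also have "\<dots> = v $ i $ j"
      proof (cases "\<beta> i = \<beta> j")
        case True
        show ?thesis
        proof (cases "i = j")
          case True
          have "Im (v $ i $ i) = 0"
            using arg_cong [OF herm [of i i], of Im] by simp
          with True show ?thesis
            by (simp add: \<Delta>_def diag_matrix_def complex_eq_iff)
        next
          case False
          then have "v $ i $ j = 0"
            using v \<open>\<beta> i = \<beta> j\<close> unfolding T_def block_tangent_def by blast
          with True False show ?thesis
            by (simp add: \<Delta>_def diag_matrix_def b_def)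
        qed
      next
        case False
        define x where "x = b j - b i"
        have "x \<noteq> 0" "i \<noteq> j"
          using False by (auto simp: x_def b_def)
        then show ?thesis
          unfolding K_def vec_lambda_beta herm x_def [symmetric]
          by (simp add: \<Delta>_def diag_matrix_def)
      qed
      finally show ?thesis .
    qed
    then show ?thesis
      by (simp add: vec_eq_iff)
  qed
  have "frechet_derivative f (at 0) = f'"
    using frechet_derivative_at [OF f_deriv] by simp
  then have "inj_on (frechet_derivative f (at 0)) T"
    using f'_T by (simp add: inj_on_def)
  then have "\<forall>\<^sub>F r in at_right 0. (\<exists>g. homeomorphism (T \<inter> ball 0 r) (f ` (T \<inter> ball 0 r)) f g) \<and>
    (\<forall>x\<in>T \<inter> ball 0 r. inj_on (frechet_derivative f (at x)) T)"
    by (intro immersion_local_embedding smooth) (auto simp: T_def subspace_block_tangent)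
  moreover have "\<forall>\<^sub>F r in at_right (0 :: real). 0 < r \<and> r < 1 / 2"
    unfolding eventually_at_right_field by (intro exI [of _ "1 / 2"]) simp
  ultimately have "\<forall>\<^sub>F r in at_right 0. (0 < r \<and> r < 1 / 2) \<and>
    (\<exists>g. homeomorphism (T \<inter> ball 0 r) (f ` (T \<inter> ball 0 r)) f g) \<and>
    (\<forall>x\<in>T \<inter> ball 0 r. inj_on (frechet_derivative f (at x)) T)"
    by (rule eventually_conj [rotated])
  then obtain r g where r: "0 < r" "r < 1 / 2"
    and homeo: "homeomorphism (T \<inter> ball 0 r) (f ` (T \<inter> ball 0 r)) f g"
    and inj: "\<forall>x\<in>T \<inter> ball 0 r. inj_on (frechet_derivative f (at x)) T"
    using eventually_happens' [OF trivial_limit_at_right_real] by blast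
  define M where "M = f ` (T \<inter> ball 0 r)"
  have T: "subspace T"
    by (simp add: T_def subspace_block_tangent)
  have "0 \<in> T \<inter> ball 0 r"
    using r subspace_0 [OF T] by simp
  then have "M \<noteq> {}"
    unfolding M_def by blast
  moreover have "smooth_submanifold (dim T) M"
    unfolding smooth_submanifold_def
  proof
    \<comment> \<open>M is the image of a single chart, which serves every p with V the whole
      space.\<close>
    fix p assume "p \<in> M"
    show "\<exists>V (T' :: (complex^'n^'n) set) U f g. open V \<and> p \<in> V \<and> subspace T' \<and> dim T' = dim T \<and>
      open U \<and> smooth_on f U \<and> homeomorphism (T' \<inter> U) (M \<inter> V) f g \<and>
      (\<forall>x\<in>T' \<inter> U. inj_on (frechet_derivative f (at x)) T')"
      using T smooth homeo inj unfolding M_def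
      by (intro exI [of _ UNIV] exI [of _ T] exI [of _ "ball 0 r"] exI [of _ f] exI [of _ g]) simp
  qed
  moreover have "M \<subseteq> hermitian_with_multiplicities I k"
  proof
    fix p assume "p \<in> M"
    then obtain v where v: "v \<in> T" "norm v < r" and p: "p = f v"
      by (auto simp: M_def)
    define d where "d a = real (\<beta> a) + Re (v $ a $ a)" for a
    define \<delta> where "\<delta> a = complex_of_real (d a)" for a
    have small: "\<bar>Re (v $ a $ a)\<bar> < 1 / 2" for a
    proof -
      have "\<bar>Re (v $ a $ a)\<bar> \<le> norm (v $ a $ a)"
        by (rule abs_Re_le_cmod)
      also have "\<dots> \<le> norm (v $ a)"
        unfolding norm_vec_def [of "v $ a"] by (rule member_le_L2_set) auto
      also have "\<dots> \<le> norm v"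
        unfolding norm_vec_def [of v] by (rule member_le_L2_set) auto
      finally show ?thesis
        using v r by simp
    qed
    \<comment> \<open>Blocks neither merge nor split: labels differ by at least 1 and each is moved
      by less than 1/2, while v in T has a constant diagonal on every block.\<close>
    have "\<delta> a = \<delta> a' \<longleftrightarrow> \<beta> a = \<beta> a'" for a a'
    proof
      assume "\<delta> a = \<delta> a'"
      then have "d a = d a'"
        by (simp add: \<delta>_def)
      then show "\<beta> a = \<beta> a'"
        using small [of a] small [of a'] unfolding d_def by linarith
    next
      assume *: "\<beta> a = \<beta> a'"
      then have "v $ a $ a = v $ a' $ a'"
        using v(1) unfolding T_def block_tangent_def by blast
      with * show "\<delta> a = \<delta> a'"
        by (simp add: \<delta>_def d_def)
    qed
    then obtain c where c: "bij_betw c (range \<beta>) (range \<delta>)"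
      "\<And>i. i \<in> range \<beta> \<Longrightarrow> {a. \<delta> a = c i} = {a. \<beta> a = i}"
      using refine_enumeration [of \<delta> \<beta>] by blast
    have "D v = diag_matrix \<delta>"
      by (simp add: D_def \<Delta>_def \<delta>_def d_def b_def diag_matrix_def vec_eq_iff)
    then have "p = Q v ** diag_matrix \<delta> ** adjoint_matrix (Q v)"
      by (simp add: p f_def)
    moreover have "bij_betw c {1..I} (range \<delta>)" "\<forall>i\<in>{1..I}. card {a. \<delta> a = c i} = k i"
      using c card_\<beta> unfolding range_\<beta> by simp_all
    ultimately show "p \<in> hermitian_with_multiplicities I k"
      using unitary_diag_in_hermitian_with_multiplicities_iff [OF Q_unitary [of v], of d I k]
      unfolding \<delta>_def by blast
  qed
  ultimately show ?thesis
    using that unfolding T_def by blast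
qed

theorem theorem3:
  fixes I :: nat and k :: "nat \<Rightarrow> nat"
  assumes "\<And>i. i \<in> {1..I} \<Longrightarrow> 0 < k i"
    and "(\<Sum>i=1..I. k i) = CARD('n::finite)"
  shows "real_codimension (hermitian_matrices :: (complex^'n^'n) set)
           (hermitian_with_multiplicities I k) = (\<Sum>i=1..I. ((int (k i))\<^sup>2 - 1))"
proof -
  obtain \<beta> :: "'n \<Rightarrow> nat" where \<beta>: "range \<beta> \<subseteq> {1..I}"
    "\<And>i. i \<in> {1..I} \<Longrightarrow> card {a. \<beta> a = i} = k i"
    using block_labels_exist [OF assms(2)] by blast
  \<comment> \<open>Positivity of k i makes every label occur, so there are exactly I
    blocks.\<close>
  have "i \<in> range \<beta>" if "i \<in> {1..I}" for i
  proof -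
    have "card {a. \<beta> a = i} \<noteq> 0"
      using \<beta>(2) [OF that] assms(1) [OF that] by simp
    then show ?thesis
      by (auto simp: card_eq_0_iff)
  qed
  with \<beta>(1) have range_\<beta>: "range \<beta> = {1..I}"
    by blast
  define m where "m = dim (block_tangent \<beta> :: (complex^'n^'n) set)"
  define S :: "(complex^'n^'n) set" where "S = hermitian_with_multiplicities I k"
  have "card {(a, b). \<beta> a = \<beta> b} = (\<Sum>i=1..I. (card {a. \<beta> a = i})\<^sup>2)"
    using card_pairs_same_fibre [of "\<lambda>i. i" "{1..I}" \<beta>] by (simp add: bij_betw_def range_\<beta>)
  also have "\<dots> = (\<Sum>i=1..I. (k i)\<^sup>2)"
    using \<beta>(2) by (intro sum.cong) auto
  finally have m: "m + (\<Sum>i=1..I. (k i)\<^sup>2) = CARD('n)\<^sup>2 + I"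
    using dim_block_tangent [of \<beta>] by (simp add: range_\<beta> m_def)
  obtain M :: "(complex^'n^'n) set" where
    "M \<noteq> {}" "M \<subseteq> hermitian_with_multiplicities I k" "smooth_submanifold m M"
    unfolding m_def using submanifold_exists [OF range_\<beta> \<beta>(2)] by blast
  \<comment> \<open>The supremum is attained by M; any competing dimension m' satisfies as an
    inequality the relation that m satisfies as an equation.\<close>
  then have "real_dimension S = m"
    unfolding real_dimension_def S_def
  proof (intro cSup_eq_maximum)
    fix m' assume "m' \<in> {d. \<exists>M. M \<noteq> {} \<and> M \<subseteq> (hermitian_with_multiplicities I k :: (complex^'n^'n) set) \<and>
      smooth_submanifold d M}"
    then show "m' \<le> m"
      using dim_submanifold_le [where 'n = 'n and m = m' and I = I and k = k] m by fastforce
  qed blast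
  then have "real_codimension (hermitian_matrices :: (complex^'n^'n) set) S =
      int (CARD('n)\<^sup>2) - int m"
    by (simp add: real_codimension_def dim_hermitian_matrices)
  also have "\<dots> = int (\<Sum>i=1..I. (k i)\<^sup>2) - int I"
    using m by linarith
  also have "\<dots> = (\<Sum>i=1..I. ((int (k i))\<^sup>2 - 1))"
    by (simp add: sum_subtractf)
  finally show ?thesis
    by (simp add: S_def)
qed

end
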